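(* Every harmonic map $F:\mathbb D\to\mathbb D^n$ satisfies $$\mathcal H_{\mathbb D^n}(F(z);dF_z\xi)\le\frac{2|\xi|}{1-|z|^2}$$ for every $z\in\mathbb D$ and every tangent vector $\xi\in T_z\mathbb D$. Consequently, $d_{\mathcal H}(F(z_0),F(z_1))\le d_{\mathbb D}(z_0,z_1)$ for all $z_0,z_1\in\mathbb D$. The constant in the infinitesimal inequality is sharp (the right-hand side cannot be multiplied by a constant smaller than $1$ so that the inequality remains valid for all harmonic $F:\mathbb D\to\mathbb D^n$, all $z$ and all $\xi$).
   Context: $\mathbb D=\{z\in\mathbb C:|z|<1\}$; harmonic maps into $\mathbb C^n$ are understood componentwise and $dF_z$ is the real differential. $d_{\mathbb D}$ is the Poincaré distance induced by the curvature $-1$ density $2/(1-|z|^2)$. The function $\mathcal M:[0,1)\to(0,\infty)$ is given by $\mathcal M(0)=4/\pi$ and, for $0<r<1$, $$\mathcal M(r)=2\int_0^{2\pi}\frac{\cos^2t}{\sqrt{\lambda(r)^2+\cos^2t}}\,\frac{dt}{2\pi},$$ where $\lambda(r)>0$ is the unique positive solution of $$r=\int_0^{2\pi}\frac{\lambda(r)}{\sqrt{\lambda(r)^2+\cos^2t}}\,\frac{dt}{2\pi}.$$ For $p\in\mathbb D^n$ and $v\in\mathbb C^n$, $$\mathcal H_{\mathbb D^n}(p;v)=\max_{1\le j\le n}\frac{2|v_j|}{\mathcal M(|p_j|)},$$ and $d_{\mathcal H}$ is the path distance on $\mathbb D^n$ induced by $\mathcal H_{\mathbb D^n}$ (infimum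 of $\int\mathcal H_{\mathbb D^n}(\gamma;\gamma')\,ds$ over piecewise $C^1$ curves joining the points). *)

theory Defs
  imports "HOL-Analysis.Analysis"
begin

text \<open>Directional derivative; the directions \<open>1\<close> and \<open>\<i>\<close> give the two real
  partial derivatives of a function of a complex variable.\<close>

definition dir_deriv :: "complex \<Rightarrow> (complex \<Rightarrow> complex) \<Rightarrow> complex \<Rightarrow> complex" where
  "dir_deriv u f z = frechet_derivative f (at z) u"

text \<open>The domain \<open>U\<close> is meant to be open.\<close>

definition C2_on :: "(complex \<Rightarrow> complex) \<Rightarrow> complex set \<Rightarrow> bool" where
  "C2_on f U \<longleftrightarrow>
     (\<forall>z\<in>U. f differentiable (at z)) \<and>
     (\<forall>u\<in>{1, \<i>}. \<forall>z\<in>U. dir_deriv u f differentiable (at z)) \<and>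
     (\<forall>u\<in>{1, \<i>}. \<forall>v\<in>{1, \<i>}. continuous_on U (dir_deriv v (dir_deriv u f)))"

definition harmonic_on :: "(complex \<Rightarrow> complex) \<Rightarrow> complex set \<Rightarrow> bool" where
  "harmonic_on f U \<longleftrightarrow> C2_on f U \<and>
     (\<forall>z\<in>U. dir_deriv 1 (dir_deriv 1 f) z + dir_deriv \<i> (dir_deriv \<i> f) z = 0)"

definition harmonic_map_on :: "(complex \<Rightarrow> complex ^ 'n) \<Rightarrow> complex set \<Rightarrow> bool" where
  "harmonic_map_on F U \<longleftrightarrow> (\<forall>j. harmonic_on (\<lambda>z. F z $ j) U)"

definition polydisc :: "(complex ^ 'n) set" where
  "polydisc = {p. \<forall>j. cmod (p $ j) < 1}"

definition M_param :: "real \<Rightarrow> real" where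
  "M_param r = (THE l. 0 < l \<and>
     r = integral {0..2 * pi} (\<lambda>t. l / sqrt (l\<^sup>2 + (cos t)\<^sup>2)) / (2 * pi))"

text \<open>Only the values on \<open>[0, 1)\<close> are meaningful.\<close>

definition M_fun :: "real \<Rightarrow> real" where
  "M_fun r = (if r = 0 then 4 / pi
     else 2 * (integral {0..2 * pi}
            (\<lambda>t. (cos t)\<^sup>2 / sqrt ((M_param r)\<^sup>2 + (cos t)\<^sup>2)) / (2 * pi)))"

definition H_metric :: "complex ^ 'n \<Rightarrow> complex ^ 'n \<Rightarrow> real" where
  "H_metric p v = Max (range (\<lambda>j. 2 * cmod (v $ j) / M_fun (cmod (p $ j))))"

definition poincare_metric :: "complex \<Rightarrow> complex \<Rightarrow> real" where
  "poincare_metric z \<xi> = 2 * cmod \<xi> / (1 - (cmod z)\<^sup>2)"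

text \<open>Piecewise \<open>C\<^sup>1\<close> in the classical sense: \<open>C\<^sup>1\<close> up to the endpoints on each closed
  subinterval of a partition of \<open>[0, 1]\<close>. The library's \<open>piecewise_C1_differentiable_on\<close>
  allows the derivative to be unbounded near the exceptional points; the speed of such a
  curve may fail to be integrable, and \<open>integral\<close> would then give it length \<open>0\<close>.\<close>

definition C1_on_interval :: "(real \<Rightarrow> 'a::real_normed_vector) \<Rightarrow> real \<Rightarrow> real \<Rightarrow> bool" where
  "C1_on_interval \<gamma> a b \<longleftrightarrow> (\<exists>\<gamma>'. continuous_on {a..b} \<gamma>' \<and>
     (\<forall>t\<in>{a..b}. (\<gamma> has_vector_derivative \<gamma>' t) (at t within {a..b})))"

definition piecewise_C1_path :: "(real \<Rightarrow> 'a::real_normed_vector) \<Rightarrow> bool" where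
  "piecewise_C1_path \<gamma> \<longleftrightarrow> (\<exists>(s :: nat \<Rightarrow> real) m. s 0 = 0 \<and> s m = 1 \<and>
     (\<forall>i<m. s i < s (Suc i) \<and> C1_on_interval \<gamma> (s i) (s (Suc i))))"

text \<open>The vector derivative is arbitrary at the break points and at the endpoints of
  \<open>[0, 1]\<close>; these finitely many values do not affect the integral.\<close>

definition metric_length ::
    "('a \<Rightarrow> 'a \<Rightarrow> real) \<Rightarrow> (real \<Rightarrow> 'a::real_normed_vector) \<Rightarrow> real" where
  "metric_length N \<gamma> = integral {0..1} (\<lambda>t. N (\<gamma> t) (vector_derivative \<gamma> (at t)))"

definition path_dist ::
    "'a set \<Rightarrow> ('a \<Rightarrow> 'a \<Rightarrow> real) \<Rightarrow> 'a \<Rightarrow> 'a::real_normed_vector \<Rightarrow> real" where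
  "path_dist S N p q = Inf {metric_length N \<gamma> | \<gamma>.
     piecewise_C1_path \<gamma> \<and> path_image \<gamma> \<subseteq> S \<and> pathstart \<gamma> = p \<and> pathfinish \<gamma> = q}"

definition poincare_dist :: "complex \<Rightarrow> complex \<Rightarrow> real" where
  "poincare_dist = path_dist (ball 0 1) poincare_metric"

definition H_dist :: "complex ^ 'n \<Rightarrow> complex ^ 'n \<Rightarrow> real" where
  "H_dist = path_dist polydisc H_metric"

end

theory Submission
  imports Defs "HOL-Complex_Analysis.Complex_Analysis"
begin

text \<open>
  On the disc a harmonic function is \<open>g + cnj k\<close> with \<open>g\<close> and \<open>k\<close> holomorphic, so composing with a
  Moebius map keeps it harmonic and reduces the derivative estimate to the origin. There the value \<open>p\<close>
  and the derivative are the means of \<open>f\<close> and \<open>2 f cos t\<close> over circles, and bounding the derivative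
  for given \<open>p\<close> is a linear extremal problem over functions of modulus at most \<open>1\<close>; \<open>M_param \<bar>p\<bar>\<close> is
  its Lagrange multiplier. Integrating along curves gives the inequality of distances, and
  \<open>(4 / pi) Re (Arctan z)\<close> in each coordinate attains equality at the origin.
\<close>

section \<open>Symmetry of second derivatives\<close>


text \<open>Each l > 0 bounds the derivative by twice the mean of sqrt(l^2 + cos^2 t) minus l * |p|.
  This is convex in l and is minimal where the l-derivative of that mean equals |p|, which is the
  equation defining \<open>M_param\<close>. For p = 0 the minimizer degenerates to l = 0 and the
  mean becomes that of |cos t|; hence the separate value 4/pi. The values are complex, so the
  derivative may have any phase relative to p, while the bound sees only |p|. It survives because
  the relative phase enters only as a factor of cos t / sqrt(l^2 + cos^2 t), whose mean is zero.
  Harmonicity is given by second partial derivatives, so the holomorphic structure has to be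
  extracted first. The Cauchy-Riemann equations needed for that combine the Laplace equation with
  the equality of mixed partials, which is why the symmetry of second derivatives comes at the
  start.\<close>

lemma second_difference_limit:
  fixes f :: "complex \<Rightarrow> complex"
  assumes "open U" "a \<in> U" and f: "\<And>z. z \<in> U \<Longrightarrow> f differentiable (at z)"
    and "dir_deriv u f differentiable (at a)"
  shows "((\<lambda>h. (f (a + of_real h * u + of_real h * v) - f (a + of_real h * u)
            - f (a + of_real h * v) + f a) / of_real (h\<^sup>2))
          \<longlongrightarrow> dir_deriv v (dir_deriv u f) a) (at_right 0)"
proof -
  define g where "g = dir_deriv u f"
  define g' where "g' = frechet_derivative g (at a)"
  have g': "(g has_derivative g') (at a)"
    using assms(4) by (simp add: g_def g'_def frechet_derivative_works)
  interpret g': bounded_linear g' using g' by (rule has_derivative_bounded_linear)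
  \<comment> \<open>Two first-order remainders of \<open>g\<close> occur below, at points within
    \<open>h * (cmod u + cmod v)\<close> and \<open>h * cmod u\<close> of \<open>a\<close>;
    \<open>K\<close> covers both, and the summand 1 keeps it positive.\<close>
  define K where "K = 2 * cmod u + cmod v + 1"
  have K: "K > 0" by (simp add: K_def add_nonneg_pos)
  have line: "((\<lambda>s. f (b + of_real s * u)) has_vector_derivative g (b + of_real s * u)) (at s within S)"
    if "b + of_real s * u \<in> U" for b s S
  proof -
    have "(f has_derivative frechet_derivative f (at (b + of_real s * u))) (at (b + of_real s * u))"
      using f[OF that] by (simp add: frechet_derivative_works)
    then have "((\<lambda>s. f (b + of_real s * u)) has_derivative
        (\<lambda>t. frechet_derivative f (at (b + of_real s * u)) (of_real t * u))) (at s within S)"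
      by (rule has_derivative_compose[rotated]) (auto intro!: derivative_eq_intros)
    moreover have "linear (frechet_derivative f (at (b + of_real s * u)))"
      using f[OF that] by (rule linear_frechet_derivative)
    ultimately show ?thesis
      unfolding has_vector_derivative_def g_def dir_deriv_def
      by (simp add: linear_scale flip: scaleR_conv_of_real)
  qed
  show ?thesis
  proof (rule tendstoI)
    fix e :: real assume e: "e > 0"
    define \<epsilon> where "\<epsilon> = e / (2 * K)"
    have \<epsilon>: "\<epsilon> > 0" using e K by (simp add: \<epsilon>_def)
    obtain d1 where d1: "d1 > 0" "\<And>y. norm (y - a) < d1 \<Longrightarrow> norm (g y - g a - g' (y - a)) \<le> \<epsilon> * norm (y - a)"
      using g' \<epsilon> unfolding has_derivative_at_alt by blast
    obtain d2 where d2: "d2 > 0" "ball a d2 \<subseteq> U"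
      using \<open>open U\<close> \<open>a \<in> U\<close> openE by blast
    define d where "d = min d1 d2 / K"
    have d: "d > 0" using d1 d2 K by (simp add: d_def)
    have "dist ((f (a + of_real h * u + of_real h * v) - f (a + of_real h * u)
            - f (a + of_real h * v) + f a) / of_real (h\<^sup>2)) (g' v) < e" if h: "0 < h" "h < d" for h
    proof -
      have hK: "h * K < min d1 d2" using h K by (simp add: d_def pos_less_divide_eq)
      have near: "norm (of_real s * u + of_real r * v) < min d1 d2"
        if "0 \<le> s" "s \<le> h" "0 \<le> r" "r \<le> h" for s r
      proof -
        have "norm (of_real s * u + of_real r * v) \<le> s * cmod u + r * cmod v"
          using that by (intro norm_triangle_le) (simp add: norm_mult)
        also have "\<dots> \<le> h * cmod u + h * cmod v" using that by (intro add_mono mult_right_mono) auto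
        also have "\<dots> \<le> h * K" using h by (auto simp: K_def algebra_simps)
        finally show ?thesis using hK by simp
      qed
      \<comment> \<open>The increment in direction \<open>v\<close>, viewed as a function along
        \<open>u\<close>, minus its linear prediction. \<open>\<phi> h - \<phi> 0\<close> is the
        second difference minus \<open>h\<^sup>2 * g' v\<close>, so the mean value inequality
        reduces the claim to a bound on \<open>\<phi>'\<close>, where differentiability of
        \<open>g\<close> at the single point \<open>a\<close> is enough.\<close>
      define \<phi> where "\<phi> s = f ((a + of_real h * v) + of_real s * u) - f (a + of_real s * u) - of_real s * (of_real h * g' v)" for s
      define \<phi>' where "\<phi>' s = g ((a + of_real h * v) + of_real s * u) - g (a + of_real s * u) - of_real h * g' v" for s
      have der: "(\<phi> has_vector_derivative \<phi>' s) (at s within {0..h})" if "s \<in> {0..h}" for s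
      proof -
        have "(a + of_real h * v) + of_real s * u \<in> ball a d2" "a + of_real s * u \<in> ball a d2"
          using near[of s h] near[of s 0] that h
          by (auto simp: dist_norm norm_minus_commute algebra_simps)
        then have "(a + of_real h * v) + of_real s * u \<in> U" "a + of_real s * u \<in> U" using d2 by auto
        then show ?thesis unfolding \<phi>_def \<phi>'_def
          by (auto intro!: derivative_eq_intros line)
      qed
      have bd: "norm (\<phi>' s) \<le> \<epsilon> * (h * K)" if "s \<in> {0..h}" for s
      proof -
        let ?x = "of_real s * u + of_real h * v" and ?y = "of_real s * u + of_real 0 * v"
        have 1: "norm (g (a + ?x) - g a - g' ?x) \<le> \<epsilon> * norm ?x"
          using d1(2)[of "a + ?x"] near[of s h] that h by auto
        have 2: "norm (g (a + ?y) - g a - g' ?y) \<le> \<epsilon> * norm ?y"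
          using d1(2)[of "a + ?y"] near[of s 0] that h by auto
        have "g' ?x - g' ?y = of_real h * g' v"
          by (simp add: g'.add g'.scaleR flip: scaleR_conv_of_real)
        then have "\<phi>' s = (g (a + ?x) - g a - g' ?x) - (g (a + ?y) - g a - g' ?y)"
          by (simp add: \<phi>'_def algebra_simps)
        then have "norm (\<phi>' s) \<le> \<epsilon> * norm ?x + \<epsilon> * norm ?y"
          using norm_triangle_ineq4 1 2 by (smt (verit))
        also have "norm ?x \<le> s * cmod u + h * cmod v"
          using that by (intro norm_triangle_le) (simp add: norm_mult)
        also have "norm ?y = s * cmod u" using that by (simp add: norm_mult)
        also have "\<epsilon> * (s * cmod u + h * cmod v) + \<epsilon> * (s * cmod u) = \<epsilon> * (s * (2 * cmod u) + h * cmod v)"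
          by (simp add: algebra_simps)
        also have "\<dots> \<le> \<epsilon> * (h * (2 * cmod u) + h * cmod v)"
          using that \<epsilon> by (intro mult_left_mono add_mono mult_right_mono) auto
        also have "\<dots> \<le> \<epsilon> * (h * K)" using \<epsilon> h by (intro mult_left_mono) (auto simp: K_def algebra_simps)
        finally show ?thesis using \<epsilon> by simp
      qed
      have "norm (\<phi> h - \<phi> 0) \<le> (\<epsilon> * (h * K)) * norm (h - 0)"
      proof (rule differentiable_bound[of "{0..h}" \<phi> "\<lambda>s t. t *\<^sub>R \<phi>' s"])
        show "(\<phi> has_derivative (\<lambda>t. t *\<^sub>R \<phi>' s)) (at s within {0..h})" if "s \<in> {0..h}" for s
          using der[OF that] by (simp add: has_vector_derivative_def)
        show "onorm (\<lambda>t. t *\<^sub>R \<phi>' s) \<le> \<epsilon> * (h * K)" if "s \<in> {0..h}" for s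
          by (intro onorm_le) (use mult_left_mono[OF bd[OF that] abs_ge_zero] in \<open>simp add: mult_ac\<close>)
      qed (use h in auto)
      moreover have "\<phi> h - \<phi> 0 = (f (a + of_real h * u + of_real h * v) - f (a + of_real h * u)
            - f (a + of_real h * v) + f a) - of_real (h\<^sup>2) * g' v" (is "_ = ?D - _")
        by (simp add: \<phi>_def algebra_simps power2_eq_square)
      ultimately have "norm (?D - of_real (h\<^sup>2) * g' v) \<le> \<epsilon> * K * h\<^sup>2"
        using h by (simp add: power2_eq_square mult_ac)
      also have "\<dots> < e * h\<^sup>2" using e h K by (simp add: \<epsilon>_def)
      finally have "norm (?D - of_real (h\<^sup>2) * g' v) / h\<^sup>2 < e" using h by (simp add: pos_divide_less_eq)
      moreover have "?D / of_real (h\<^sup>2) - g' v = (?D - of_real (h\<^sup>2) * g' v) / of_real (h\<^sup>2)"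
        using h by (simp add: field_simps)
      ultimately show ?thesis
        by (simp add: dist_norm norm_divide norm_power)
    qed
    then show "eventually (\<lambda>h. dist ((f (a + of_real h * u + of_real h * v) - f (a + of_real h * u)
            - f (a + of_real h * v) + f a) / of_real (h\<^sup>2)) (dir_deriv v (dir_deriv u f) a) < e) (at_right 0)"
      unfolding eventually_at_right_field dir_deriv_def[of v] g_def[symmetric] g'_def[symmetric]
      using d by blast
  qed
qed

text \<open>The second difference is symmetric in \<open>u\<close> and \<open>v\<close>, so both
  iterated derivatives are limits of one expression.\<close>

lemma dir_deriv_commute:
  assumes "open U" "a \<in> U" "\<And>z. z \<in> U \<Longrightarrow> f differentiable (at z)"
    and "dir_deriv u f differentiable (at a)" "dir_deriv v f differentiable (at a)"
  shows "dir_deriv v (dir_deriv u f) a = dir_deriv u (dir_deriv v f) a"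
proof (rule tendsto_unique)
  show "((\<lambda>h. (f (a + of_real h * u + of_real h * v) - f (a + of_real h * u)
            - f (a + of_real h * v) + f a) / of_real (h\<^sup>2))
          \<longlongrightarrow> dir_deriv v (dir_deriv u f) a) (at_right 0)"
    by (rule second_difference_limit) (use assms in auto)
  show "((\<lambda>h. (f (a + of_real h * u + of_real h * v) - f (a + of_real h * u)
            - f (a + of_real h * v) + f a) / of_real (h\<^sup>2))
          \<longlongrightarrow> dir_deriv u (dir_deriv v f) a) (at_right 0)"
    using second_difference_limit[of U a f v u] assms by (simp add: algebra_simps)
qed simp

section \<open>Harmonic functions as sums of holomorphic and antiholomorphic ones\<close>


lemma has_derivative_holomorphic_plus_cnj:
  assumes "open U" "g holomorphic_on U" "k holomorphic_on U" "z \<in> U"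
    and "\<And>z. z \<in> U \<Longrightarrow> f z = g z + cnj (k z)"
  shows "(f has_derivative (\<lambda>\<xi>. deriv g z * \<xi> + cnj (deriv k z * \<xi>))) (at z)"
proof -
  have "(g has_derivative (*) (deriv g z)) (at z)" "(k has_derivative (*) (deriv k z)) (at z)"
    using assms holomorphic_derivI by (auto simp flip: has_field_derivative_def)
  then have "((\<lambda>z. g z + cnj (k z)) has_derivative (\<lambda>\<xi>. deriv g z * \<xi> + cnj (deriv k z * \<xi>))) (at z)"
    by (auto intro!: derivative_eq_intros has_derivative_cnj)
  then show ?thesis
    by (rule has_derivative_transform_within_open[OF _ assms(1,4)]) (use assms in auto)
qed

lemma dir_deriv_holomorphic_plus_cnj:
  assumes "open U" "g holomorphic_on U" "k holomorphic_on U" "z \<in> U"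
    and "\<And>z. z \<in> U \<Longrightarrow> f z = g z + cnj (k z)"
  shows "dir_deriv u f z = deriv g z * u + cnj (deriv k z * u)"
  using fun_cong[OF frechet_derivative_at[OF has_derivative_holomorphic_plus_cnj[OF assms]], of u]
  by (simp add: dir_deriv_def)

text \<open>Differentiation preserves the shape holomorphic plus antiholomorphic and multiplies each
  part's derivative by the direction. Two derivatives in direction u give the factor u^2, and 1 +
  \<i>^2 = 0 kills the Laplacian.\<close>

lemma harmonic_on_holomorphic_plus_cnj:
  assumes U: "open U" "g holomorphic_on U" "k holomorphic_on U"
    and f: "\<And>z. z \<in> U \<Longrightarrow> f z = g z + cnj (k z)"
  shows "harmonic_on f U"
proof -
  have hol1: "(\<lambda>z. deriv g z * u) holomorphic_on U" "(\<lambda>z. deriv k z * u) holomorphic_on U" for u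
    using U by (auto intro!: holomorphic_intros)
  have d1: "dir_deriv u f z = deriv g z * u + cnj (deriv k z * u)" if "z \<in> U" for u z
    using dir_deriv_holomorphic_plus_cnj[OF U that f] .
  have d2: "dir_deriv v (dir_deriv u f) z = deriv (deriv g) z * u * v + cnj (deriv (deriv k) z * u * v)"
    if "z \<in> U" for u v z
  proof -
    have "deriv (\<lambda>z. deriv g z * u) z = deriv (deriv g) z * u"
      "deriv (\<lambda>z. deriv k z * u) z = deriv (deriv k) z * u"
      using U that holomorphic_on_imp_differentiable_at[OF holomorphic_deriv, of _ U z] by simp_all
    then show ?thesis
      using dir_deriv_holomorphic_plus_cnj[OF U(1) hol1 that d1] by simp
  qed
  have "f differentiable (at z)" "dir_deriv u f differentiable (at z)" if "z \<in> U" for u z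
    using has_derivative_holomorphic_plus_cnj[OF U that f]
      has_derivative_holomorphic_plus_cnj[OF U(1) hol1 that d1] by (auto simp: differentiable_def)
  moreover have "continuous_on U (dir_deriv v (dir_deriv u f))" for u v
  proof -
    have "continuous_on U (\<lambda>z. deriv (deriv g) z * u * v + cnj (deriv (deriv k) z * u * v))"
      using U by (intro continuous_intros continuous_on_cnj holomorphic_on_imp_continuous_on) (auto intro!: holomorphic_intros)
    then show ?thesis by (rule continuous_on_eq) (simp add: d2)
  qed
  ultimately show ?thesis
    by (simp add: harmonic_on_def C2_on_def d2 algebra_simps)
qed

lemma linear_complex_expand:
  fixes T :: "complex \<Rightarrow> complex"
  assumes "linear T"
  shows "T \<xi> = of_real (Re \<xi>) * T 1 + of_real (Im \<xi>) * T \<i>"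
proof -
  have "\<xi> = Re \<xi> *\<^sub>R 1 + Im \<xi> *\<^sub>R \<i>" by (simp add: complex_eq_iff)
  then have "T \<xi> = T (Re \<xi> *\<^sub>R 1 + Im \<xi> *\<^sub>R \<i>)" by (rule arg_cong)
  also have "\<dots> = Re \<xi> *\<^sub>R T 1 + Im \<xi> *\<^sub>R T \<i>"
    by (simp only: linear_add[OF assms] linear_scale[OF assms])
  finally show ?thesis by (simp add: scaleR_conv_of_real)
qed

text \<open>This function is twice the Wirtinger derivative of \<open>f\<close> with respect to z.
  Its Cauchy-Riemann equations are the Laplace equation and the equality of the mixed
  derivatives.\<close>

lemma holomorphic_on_complex_gradient:
  assumes "open U" "harmonic_on f U"
  shows "(\<lambda>z. dir_deriv 1 f z - \<i> * dir_deriv \<i> f z) holomorphic_on U"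
  unfolding holomorphic_on_open[OF assms(1)]
proof
  fix z assume z: "z \<in> U"
  have C2: "C2_on f U" and lap: "dir_deriv 1 (dir_deriv 1 f) z + dir_deriv \<i> (dir_deriv \<i> f) z = 0"
    using assms z by (auto simp: harmonic_on_def)
  have D: "dir_deriv 1 f differentiable (at z)" "dir_deriv \<i> f differentiable (at z)"
    using C2 z by (auto simp: C2_on_def)
  have comm: "dir_deriv \<i> (dir_deriv 1 f) z = dir_deriv 1 (dir_deriv \<i> f) z"
    by (rule dir_deriv_commute[OF assms(1) z]) (use C2 D in \<open>auto simp: C2_on_def\<close>)
  define A B where "A = frechet_derivative (dir_deriv 1 f) (at z)"
    and "B = frechet_derivative (dir_deriv \<i> f) (at z)"
  have AB: "(dir_deriv 1 f has_derivative A) (at z)" "(dir_deriv \<i> f has_derivative B) (at z)"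
    using D by (auto simp: A_def B_def frechet_derivative_works)
  have lin: "linear A" "linear B"
    using AB has_derivative_linear by auto
  have *: "A 1 + B \<i> = 0" "A \<i> = B 1"
    using lap comm by (simp_all add: A_def B_def dir_deriv_def)
  have eq: "(\<lambda>\<xi>. A \<xi> - \<i> * B \<xi>) = (*) (A 1 - \<i> * B 1)"
  proof
    fix \<xi>
    have "B \<i> = - A 1" using *(1) by (rule minus_unique[symmetric])
    then have "A \<xi> - \<i> * B \<xi> = (A 1 - \<i> * B 1) * (of_real (Re \<xi>) + \<i> * of_real (Im \<xi>))"
      unfolding linear_complex_expand[OF lin(1), of \<xi>] linear_complex_expand[OF lin(2), of \<xi>] *(2) by (simp add: algebra_simps)
    moreover have "of_real (Re \<xi>) + \<i> * of_real (Im \<xi>) = \<xi>" by (simp add: complex_eq_iff)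
    ultimately show "A \<xi> - \<i> * B \<xi> = (A 1 - \<i> * B 1) * \<xi>" by (simp only:)
  qed
  have "((\<lambda>z. dir_deriv 1 f z - \<i> * dir_deriv \<i> f z) has_derivative (\<lambda>\<xi>. A \<xi> - \<i> * B \<xi>)) (at z)"
    by (intro has_derivative_diff has_derivative_mult_right AB)
  then have "((\<lambda>z. dir_deriv 1 f z - \<i> * dir_deriv \<i> f z) has_field_derivative A 1 - \<i> * B 1) (at z)"
    by (simp only: has_field_derivative_def eq)
  then show "\<exists>f'. ((\<lambda>z. dir_deriv 1 f z - \<i> * dir_deriv \<i> f z) has_field_derivative f') (at z)"
    by blast
qed

lemma dir_deriv_cnj:
  assumes "f differentiable (at z)"
  shows "dir_deriv u (\<lambda>z. cnj (f z)) z = cnj (dir_deriv u f z)"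
proof -
  have "((\<lambda>z. cnj (f z)) has_derivative (\<lambda>\<xi>. cnj (frechet_derivative f (at z) \<xi>))) (at z)"
    using assms by (intro has_derivative_cnj) (simp add: frechet_derivative_works)
  from fun_cong[OF frechet_derivative_at[OF this], of u] show ?thesis
    by (simp add: dir_deriv_def)
qed

lemma dir_deriv_cong:
  assumes "open U" "z \<in> U" "\<And>z. z \<in> U \<Longrightarrow> f z = g z"
  shows "dir_deriv u f z = dir_deriv u g z"
proof -
  have "(f has_derivative D) (at z) \<longleftrightarrow> (g has_derivative D) (at z)" for D
    using has_derivative_transform_within_open[OF _ assms(1,2)] assms(3) by metis
  then show ?thesis by (simp add: dir_deriv_def frechet_derivative_def)
qed

text \<open>The derivative of f with respect to the conjugate variable is the conjugate of the
  z-derivative of \<open>cnj f\<close>. This lemma lets the antiholomorphic part be built by the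
  same construction as the holomorphic one.\<close>

lemma harmonic_on_cnj:
  assumes U: "open U" and f: "harmonic_on f U"
  shows "harmonic_on (\<lambda>z. cnj (f z)) U"
proof -
  have C2: "C2_on f U" using f by (simp add: harmonic_on_def)
  have d1: "dir_deriv u (\<lambda>z. cnj (f z)) z = cnj (dir_deriv u f z)" if "z \<in> U" for u z
    using C2 that by (intro dir_deriv_cnj) (auto simp: C2_on_def)
  have d2: "dir_deriv v (dir_deriv u (\<lambda>z. cnj (f z))) z = cnj (dir_deriv v (dir_deriv u f) z)"
    if "z \<in> U" "u \<in> {1, \<i>}" for u v z
  proof -
    have "dir_deriv v (dir_deriv u (\<lambda>z. cnj (f z))) z = dir_deriv v (\<lambda>z. cnj (dir_deriv u f z)) z"
      using U that(1) d1 by (rule dir_deriv_cong)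
    also have "\<dots> = cnj (dir_deriv v (dir_deriv u f) z)"
      using C2 that by (intro dir_deriv_cnj) (auto simp: C2_on_def)
    finally show ?thesis .
  qed
  have cd: "(\<lambda>z. cnj (h z)) differentiable (at z)" if "h differentiable (at z)" for h z
    using that has_derivative_cnj unfolding differentiable_def by blast
  have "dir_deriv u (\<lambda>z. cnj (f z)) differentiable (at z)" if "z \<in> U" "u \<in> {1, \<i>}" for u z
  proof -
    have "(\<lambda>z. cnj (dir_deriv u f z)) differentiable (at z)"
      using C2 that by (intro cd) (auto simp: C2_on_def)
    then obtain D where "((\<lambda>z. cnj (dir_deriv u f z)) has_derivative D) (at z)"
      by (auto simp: differentiable_def)
    then have "(dir_deriv u (\<lambda>z. cnj (f z)) has_derivative D) (at z)"
      by (rule has_derivative_transform_within_open[OF _ U that(1)]) (simp add: d1)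
    then show ?thesis by (auto simp: differentiable_def)
  qed
  moreover have "continuous_on U (dir_deriv v (dir_deriv u (\<lambda>z. cnj (f z))))"
    if "u \<in> {1, \<i>}" "v \<in> {1, \<i>}" for u v
  proof -
    have "continuous_on U (\<lambda>z. cnj (dir_deriv v (dir_deriv u f) z))"
      using C2 that by (intro continuous_on_cnj) (auto simp: C2_on_def)
    then show ?thesis by (rule continuous_on_eq) (use d2 that in auto)
  qed
  moreover have "(\<lambda>z. cnj (f z)) differentiable (at z)" if "z \<in> U" for z
    using C2 that by (intro cd) (auto simp: C2_on_def)
  moreover have "dir_deriv 1 (dir_deriv 1 (\<lambda>z. cnj (f z))) z + dir_deriv \<i> (dir_deriv \<i> (\<lambda>z. cnj (f z))) z = 0"
    if "z \<in> U" for z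
    using f that by (simp add: d2 harmonic_on_def flip: complex_cnj_add)
  ultimately show ?thesis unfolding harmonic_on_def C2_on_def by blast
qed

text \<open>Convexity provides primitives \<open>g\<close> and \<open>k\<close> of the z-derivatives
  of \<open>f\<close> and of \<open>cnj f\<close>. Then \<open>g + cnj k\<close> has the same real
  differential as \<open>f\<close>, so the difference is a constant, which is absorbed into
  \<open>g\<close>.\<close>

lemma harmonic_on_decomposition:
  assumes U: "open U" "convex U" and f: "harmonic_on f U"
  obtains g k where "g holomorphic_on U" "k holomorphic_on U" "\<And>z. z \<in> U \<Longrightarrow> f z = g z + cnj (k z)"
proof (cases "U = {}")
  case True
  then show ?thesis using that[of id id] by simp
next
  case False
  then obtain z0 where z0: "z0 \<in> U" by blast
  let ?df = "\<lambda>f z. (dir_deriv 1 f z - \<i> * dir_deriv \<i> f z) / 2"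
  have hol: "?df h holomorphic_on U" if "harmonic_on h U" for h
    by (rule holomorphic_on_divide[OF holomorphic_on_complex_gradient[OF U(1) that]]) auto
  obtain g where g: "\<And>z. z \<in> U \<Longrightarrow> (g has_field_derivative ?df f z) (at z)"
    using holomorphic_convex_primitive'[OF U(2,1) hol[OF f]] U(1) by (metis at_within_open)
  obtain k where k: "\<And>z. z \<in> U \<Longrightarrow> (k has_field_derivative ?df (\<lambda>z. cnj (f z)) z) (at z)"
    using holomorphic_convex_primitive'[OF U(2,1) hol[OF harmonic_on_cnj[OF U(1) f]]] U(1)
    by (metis at_within_open)
  \<comment> \<open>With \<open>p\<close> and \<open>q\<close> the partial derivatives in the
    directions 1 and \<i>, this splits a real-linear map into its complex-linear and
    conjugate-linear parts.\<close>
  have split: "of_real (Re \<xi>) * p + of_real (Im \<xi>) * q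
      = (p - \<i> * q) / 2 * \<xi> + cnj ((cnj p - \<i> * cnj q) / 2 * \<xi>)" for \<xi> p q :: complex
    by (simp add: complex_eq_iff field_simps)
  have "((\<lambda>z. f z - (g z + cnj (k z))) has_derivative (\<lambda>\<xi>. 0)) (at z within U)" if "z \<in> U" for z
  proof -
    have fd: "f differentiable (at z)" using f that by (auto simp: harmonic_on_def C2_on_def)
    define T where "T = frechet_derivative f (at z)"
    have T: "(f has_derivative T) (at z)" using fd by (simp add: T_def frechet_derivative_works)
    have lin: "linear T" using T has_derivative_linear by blast
    have dd: "dir_deriv u f z = T u" for u by (simp add: dir_deriv_def T_def)
    have "((\<lambda>z. f z - (g z + cnj (k z))) has_derivative
        (\<lambda>\<xi>. T \<xi> - (?df f z * \<xi> + cnj (?df (\<lambda>z. cnj (f z)) z * \<xi>)))) (at z)"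
      using g[OF that] k[OF that] T unfolding has_field_derivative_def
      by (intro has_derivative_diff has_derivative_add has_derivative_cnj)
    moreover have "T \<xi> - (?df f z * \<xi> + cnj (?df (\<lambda>z. cnj (f z)) z * \<xi>)) = 0" for \<xi>
    proof -
      have "T \<xi> = of_real (Re \<xi>) * T 1 + of_real (Im \<xi>) * T \<i>"
        using lin by (rule linear_complex_expand)
      also have "\<dots> = ?df f z * \<xi> + cnj (?df (\<lambda>z. cnj (f z)) z * \<xi>)"
        unfolding dir_deriv_cnj[OF fd] dd by (rule split)
      finally show ?thesis by simp
    qed
    ultimately show ?thesis by (simp add: has_derivative_at_withinI)
  qed
  then obtain c where c: "\<And>z. z \<in> U \<Longrightarrow> f z - (g z + cnj (k z)) = c"
    using has_derivative_zero_constant[OF U(2), of "\<lambda>z. f z - (g z + cnj (k z))"] by blast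
  show ?thesis
  proof (rule that)
    have "g holomorphic_on U"
      using g unfolding holomorphic_on_open[OF U(1)] by blast
    then show "(\<lambda>z. g z + c) holomorphic_on U"
      by (intro holomorphic_intros)
    show "k holomorphic_on U"
      using k unfolding holomorphic_on_open[OF U(1)] by blast
    show "f z = (g z + c) + cnj (k z)" if "z \<in> U" for z
      using c[OF that] by (simp add: algebra_simps)
  qed
qed

section \<open>The extremal problem on the circle\<close>


text \<open>Cauchy's formulas of order 0 and 1 rewritten in the angle; the factors
  \<open>-\<i>\<close> and \<open>-\<i> * of_real \<rho>\<close> in the proof cancel what dz and the
  denominator leave over.\<close>

lemma circle_mean:
  assumes h: "h holomorphic_on ball 0 1" and \<rho>: "0 < \<rho>" "\<rho> < 1"
  shows "((\<lambda>t. h (of_real \<rho> * cis t)) has_integral of_real (2 * pi) * h 0) {0..2 * pi}"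
    and "((\<lambda>t. h (of_real \<rho> * cis t) * cis (-t)) has_integral of_real (2 * pi * \<rho>) * deriv h 0) {0..2 * pi}"
proof -
  have sub: "cball 0 \<rho> \<subseteq> ball (0::complex) 1" using \<rho> by auto
  have "((\<lambda>u. h u / u ^ Suc k) has_contour_integral (2 * pi * \<i>) / fact k * (deriv ^^ k) h 0) (circlepath 0 \<rho>)" for k
  proof -
    have "continuous_on (cball 0 \<rho>) h" "h holomorphic_on ball 0 \<rho>"
      using h sub ball_subset_cball[of "0::complex" \<rho>]
      by (meson holomorphic_on_imp_continuous_on holomorphic_on_subset subset_trans)+
    from Cauchy_has_contour_integral_higher_derivative_circlepath[OF this, of 0 k] \<rho> show ?thesis
      by simp
  qed
  then have *: "((\<lambda>t. h (of_real \<rho> * cis t) / (of_real \<rho> * cis t) ^ Suc k * of_real \<rho> * \<i> * cis t)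
      has_integral (2 * pi * \<i>) / fact k * (deriv ^^ k) h 0) {0..2 * pi}" for k
    unfolding circlepath_def by (subst (asm) has_contour_integral_part_circlepath_iff) auto
  show "((\<lambda>t. h (of_real \<rho> * cis t)) has_integral of_real (2 * pi) * h 0) {0..2 * pi}"
  proof (rule has_integral_eq_rhs[OF has_integral_eq[rotated, OF has_integral_mult_right[OF *[of 0], of "-\<i>"]]])
    show "- \<i> * (h (of_real \<rho> * cis t) / (of_real \<rho> * cis t) ^ Suc 0 * of_real \<rho> * \<i> * cis t)
        = h (of_real \<rho> * cis t)" for t
      using \<rho> by (simp add: field_simps)
  qed (simp add: field_simps)
  show "((\<lambda>t. h (of_real \<rho> * cis t) * cis (-t)) has_integral of_real (2 * pi * \<rho>) * deriv h 0) {0..2 * pi}"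
  proof (rule has_integral_eq_rhs[OF has_integral_eq[rotated, OF has_integral_mult_right[OF *[of 1], of "-\<i> * of_real \<rho>"]]])
    show "- \<i> * of_real \<rho> * (h (of_real \<rho> * cis t) / (of_real \<rho> * cis t) ^ Suc 1 * of_real \<rho> * \<i> * cis t)
        = h (of_real \<rho> * cis t) * cis (-t)" for t
      using \<rho> by (simp add: field_simps power2_eq_square flip: cis_inverse)
  qed (simp add: field_simps)
qed

text \<open>Write cos t as half the sum of cis t and cis(-t). Against cis(-t) a holomorphic h yields
  its derivative at 0; against cis t it yields the mean of z * h z, which vanishes. The weight is
  real, so conjugation passes through, and the second integral gives the derivative of
  \<open>g + cnj k\<close> in direction 1.\<close>

lemma harmonic_circle_means:
  assumes g: "g holomorphic_on ball 0 1" and k: "k holomorphic_on ball 0 1"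
    and \<rho>: "0 < \<rho>" "\<rho> < 1"
  shows "((\<lambda>t. g (of_real \<rho> * cis t) + cnj (k (of_real \<rho> * cis t)))
           has_integral of_real (2 * pi) * (g 0 + cnj (k 0))) {0..2 * pi}"
    and "((\<lambda>t. (g (of_real \<rho> * cis t) + cnj (k (of_real \<rho> * cis t))) * of_real (cos t))
           has_integral of_real (pi * \<rho>) * (deriv g 0 + cnj (deriv k 0))) {0..2 * pi}"
proof -
  have c: "((\<lambda>t. cnj (h t)) has_integral cnj I) A" if "(h has_integral I) A" for h I and A :: "real set"
    using that has_integral_cnj[of h I A] by (simp add: o_def)
  have cosint: "((\<lambda>t. h (of_real \<rho> * cis t) * of_real (cos t)) has_integral of_real (pi * \<rho>) * deriv h 0) {0..2 * pi}"
    if h: "h holomorphic_on ball 0 1" for h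
  proof -
    have "((\<lambda>t. h (of_real \<rho> * cis t) * (of_real \<rho> * cis t)) has_integral 0) {0..2 * pi}"
      using circle_mean(1)[OF holomorphic_on_mult[OF h holomorphic_on_ident] \<rho>] by simp
    from has_integral_mult_right[OF this, of "1 / (2 * of_real \<rho>)"]
    have "((\<lambda>t. h (of_real \<rho> * cis t) * cis t / 2) has_integral 0) {0..2 * pi}"
      using \<rho> by simp
    from has_integral_add[OF this has_integral_mult_right[OF circle_mean(2)[OF h \<rho>], of "1 / 2"]]
    have "((\<lambda>t. h (of_real \<rho> * cis t) * ((cis t + cis (-t)) / 2)) has_integral of_real (pi * \<rho>) * deriv h 0) {0..2 * pi}"
      by (simp add: algebra_simps add_divide_distrib)
    moreover have "(cis t + cis (-t)) / 2 = of_real (cos t)" for t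
      by (simp add: complex_eq_iff)
    ultimately show ?thesis by simp
  qed
  show "((\<lambda>t. g (of_real \<rho> * cis t) + cnj (k (of_real \<rho> * cis t)))
           has_integral of_real (2 * pi) * (g 0 + cnj (k 0))) {0..2 * pi}"
    using has_integral_add[OF circle_mean(1)[OF g \<rho>] c[OF circle_mean(1)[OF k \<rho>]]]
    by (simp add: algebra_simps)
  show "((\<lambda>t. (g (of_real \<rho> * cis t) + cnj (k (of_real \<rho> * cis t))) * of_real (cos t))
           has_integral of_real (pi * \<rho>) * (deriv g 0 + cnj (deriv k 0))) {0..2 * pi}"
    using has_integral_add[OF cosint[OF g] c[OF cosint[OF k]]]
    by (simp add: algebra_simps)
qed

section \<open>Dual bounds for functions of modulus at most 1 on the circle\<close>

lemma sqrt_cos_pos: "0 < l \<Longrightarrow> 0 < sqrt (l\<^sup>2 + (cos t)\<^sup>2)"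
  by (simp add: add_pos_nonneg)

lemma continuous_on_sqrt_cos: "continuous_on A (\<lambda>t. sqrt (l\<^sup>2 + (cos t)\<^sup>2))"
  by (intro continuous_intros)

text \<open>The symmetry t -> pi - t explains the zero. The proof uses the periodic primitive
  \<open>arcsin (sin t / L)\<close>; L > 1 keeps the argument inside the open interval where arcsin
  is differentiable.\<close>

lemma has_integral_cos_over_sqrt:
  fixes l :: real
  assumes l: "0 < l"
  shows "((\<lambda>t. cos t / sqrt (l\<^sup>2 + (cos t)\<^sup>2)) has_integral 0) {0..2 * pi}"
proof -
  define L where "L = sqrt (l\<^sup>2 + 1)"
  have L: "L > 1" "L\<^sup>2 = l\<^sup>2 + 1" using l by (auto simp: L_def)
  have "((\<lambda>t. cos t / sqrt (l\<^sup>2 + (cos t)\<^sup>2)) has_integral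
          (arcsin (sin (2 * pi) / L) - arcsin (sin 0 / L))) {0..2 * pi}"
  proof (rule fundamental_theorem_of_calculus)
    fix t :: real
    have "\<bar>sin t\<bar> < L" using abs_sin_le_one[of t] L by linarith
    then have b: "-1 < sin t / L" "sin t / L < 1" using L by (auto simp: field_simps)
    have "1 - (sin t / L)\<^sup>2 = (L\<^sup>2 - (sin t)\<^sup>2) / L\<^sup>2"
      using L(1) by (simp add: power_divide diff_divide_distrib)
    also have "\<dots> = (l\<^sup>2 + (cos t)\<^sup>2) / L\<^sup>2"
      using L(2) by (simp add: sin_squared_eq)
    finally have "1 - (sin t / L)\<^sup>2 = (l\<^sup>2 + (cos t)\<^sup>2) / L\<^sup>2" .
    then have s: "sqrt (1 - (sin t / L)\<^sup>2) = sqrt (l\<^sup>2 + (cos t)\<^sup>2) / L"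
      using L(1) by (simp add: real_sqrt_divide)
    have "((\<lambda>t. arcsin (sin t / L)) has_real_derivative
        inverse (sqrt (1 - (sin t / L)\<^sup>2)) * (cos t / L)) (at t within {0..2 * pi})"
      using b L(1) by (auto intro!: derivative_eq_intros)
    moreover have "inverse (sqrt (1 - (sin t / L)\<^sup>2)) * (cos t / L) = cos t / sqrt (l\<^sup>2 + (cos t)\<^sup>2)"
      unfolding s using L(1) by (simp add: divide_inverse)
    ultimately show "((\<lambda>t. arcsin (sin t / L)) has_vector_derivative cos t / sqrt (l\<^sup>2 + (cos t)\<^sup>2)) (at t within {0..2 * pi})"
      by (simp only: has_real_derivative_iff_has_vector_derivative)
  qed simp
  then show ?thesis by simp
qed

text \<open>The case l = 0 of the integral of sqrt(l^2 + cos^2 t), and the source of the constant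
  4/pi.\<close>

lemma has_integral_abs_cos: "((\<lambda>t. \<bar>cos t\<bar>) has_integral 4) {0..2 * pi}"
proof -
  have p: "((\<lambda>t. \<bar>cos t\<bar>) has_integral s * (sin b - sin a)) {a..b}"
    if ab: "a \<le> b" and s: "\<And>t. t \<in> {a..b} \<Longrightarrow> \<bar>cos t\<bar> = s * cos t" for a b s :: real
  proof -
    have "((\<lambda>t. s * cos t) has_integral s * sin b - s * sin a) {a..b}"
      using ab by (intro fundamental_theorem_of_calculus[of a b "\<lambda>t. s * sin t"])
        (auto intro!: derivative_eq_intros simp flip: has_real_derivative_iff_has_vector_derivative)
    then have "((\<lambda>t. \<bar>cos t\<bar>) has_integral s * sin b - s * sin a) {a..b}"
      by (rule has_integral_eq[rotated]) (simp add: s)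
    then show ?thesis by (simp only: right_diff_distrib)
  qed
  have "((\<lambda>t. \<bar>cos t\<bar>) has_integral 1 * (sin (pi/2) - sin 0)) {0..pi/2}"
    by (rule p) (auto intro!: abs_of_nonneg cos_ge_zero)
  moreover have "((\<lambda>t. \<bar>cos t\<bar>) has_integral (-1) * (sin (3*pi/2) - sin (pi/2))) {pi/2..3*pi/2}"
  proof (rule p)
    fix t assume t: "t \<in> {pi/2..3*pi/2}"
    have "0 \<le> cos (t - pi)" using t by (intro cos_ge_zero) auto
    then show "\<bar>cos t\<bar> = -1 * cos t" by (simp add: cos_diff)
  qed simp
  moreover have "((\<lambda>t. \<bar>cos t\<bar>) has_integral 1 * (sin (2*pi) - sin (3*pi/2))) {3*pi/2..2*pi}"
  proof (rule p)
    fix t assume t: "t \<in> {3*pi/2..2*pi}"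
    have "0 \<le> cos (t - 2*pi)" using t by (intro cos_ge_zero) auto
    then show "\<bar>cos t\<bar> = 1 * cos t" by (simp add: cos_diff)
  qed simp
  moreover have "sin (3*pi/2) = - (1::real)" using sin_3over2_pi by simp
  ultimately have "((\<lambda>t. \<bar>cos t\<bar>) has_integral (1 + 2 + 1)) {0..2 * pi}"
    by (intro has_integral_combine[of 0 "3*pi/2" "2*pi"] has_integral_combine[of 0 "pi/2" "3*pi/2"]) auto
  then show ?thesis by simp
qed

lemma unimodular_normalizer:
  fixes z :: complex
  obtains a where "cmod a = 1" "a * z = of_real (cmod z)"
proof (cases "z = 0")
  case True
  then show ?thesis using that[of 1] by simp
next
  case False
  then have "cnj z / of_real (cmod z) * z = of_real (cmod z)"
    by (simp add: complex_norm_square[symmetric] power2_eq_square mult.commute[of "cnj z"])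
  then show ?thesis using False that[of "cnj z / of_real (cmod z)"] by (simp add: norm_divide)
qed

text \<open>Duality: pairing \<open>\<phi>\<close> with \<open>a cos t + l b\<close> for unimodular \<open>a\<close>, \<open>b\<close> costs at most the mean of
  \<open>\<bar>a cos t + l b\<bar>\<close>, and AM-GM replaces this by \<open>sqrt (l\<^sup>2 + cos\<^sup>2 t)\<close> up to a term with mean zero.\<close>

lemma circle_duality_bound:
  fixes \<phi> :: "real \<Rightarrow> complex"
  assumes P: "(\<phi> has_integral P) {0..2 * pi}"
    and V: "((\<lambda>t. \<phi> t * of_real (cos t)) has_integral V) {0..2 * pi}"
    and \<phi>: "\<And>t. cmod (\<phi> t) \<le> 1" and l: "0 < l"
  shows "cmod V + l * cmod P \<le> integral {0..2 * pi} (\<lambda>t. sqrt (l\<^sup>2 + (cos t)\<^sup>2))"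
proof -
  obtain a where a: "cmod a = 1" "a * V = of_real (cmod V)" by (rule unimodular_normalizer)
  obtain b where b: "cmod b = 1" "b * P = of_real (cmod P)" by (rule unimodular_normalizer)
  \<comment> \<open>The cosine of the angle between \<open>a\<close> and \<open>b\<close>: the only
    trace of the relative phase of \<open>V\<close> and \<open>P\<close>.\<close>
  define \<kappa> where "\<kappa> = Re (a * cnj b)"
  define s where "s t = sqrt (l\<^sup>2 + (cos t)\<^sup>2)" for t
  have s: "s t > 0" for t using sqrt_cos_pos[OF l] by (simp add: s_def)
  have "((\<lambda>t. a * (\<phi> t * of_real (cos t)) + of_real l * (b * \<phi> t)) has_integral
      a * V + of_real l * (b * P)) {0..2 * pi}"
    by (intro has_integral_add has_integral_mult_right P V)
  from has_integral_linear[OF this bounded_linear_Re]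
  have "((\<lambda>t. Re (a * (\<phi> t * of_real (cos t)) + of_real l * (b * \<phi> t))) has_integral
      Re (a * V + of_real l * (b * P))) {0..2 * pi}"
    by (simp only: o_def)
  then have L: "((\<lambda>t. Re (a * (\<phi> t * of_real (cos t)) + of_real l * (b * \<phi> t))) has_integral
      cmod V + l * cmod P) {0..2 * pi}"
    unfolding a b by simp
  have "((\<lambda>t. s t + l * \<kappa> * (cos t / s t)) has_integral
      integral {0..2 * pi} s + l * \<kappa> * 0) {0..2 * pi}"
  proof (intro has_integral_add has_integral_mult_right)
    show "(s has_integral integral {0..2 * pi} s) {0..2 * pi}" unfolding s_def
      by (intro integrable_integral integrable_continuous_interval continuous_on_sqrt_cos)
    show "((\<lambda>t. cos t / s t) has_integral 0) {0..2 * pi}"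
      unfolding s_def using l by (rule has_integral_cos_over_sqrt)
  qed
  then have R: "((\<lambda>t. s t + l * \<kappa> * (cos t / s t)) has_integral integral {0..2 * pi} s) {0..2 * pi}"
    by simp
  have "Re (a * (\<phi> t * of_real (cos t)) + of_real l * (b * \<phi> t)) \<le> s t + l * \<kappa> * (cos t / s t)" for t
  proof -
    define w where "w = a * of_real (cos t) + of_real l * b"
    have "(Re a)\<^sup>2 + (Im a)\<^sup>2 = 1" "(Re b)\<^sup>2 + (Im b)\<^sup>2 = 1"
      using a(1) b(1) by (auto simp: cmod_def)
    moreover have "(cmod w)\<^sup>2 = (cos t)\<^sup>2 * ((Re a)\<^sup>2 + (Im a)\<^sup>2) + l\<^sup>2 * ((Re b)\<^sup>2 + (Im b)\<^sup>2) + 2 * l * cos t * \<kappa>"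
      unfolding cmod_power2 w_def \<kappa>_def by (simp add: algebra_simps power2_eq_square)
    ultimately have w: "(cmod w)\<^sup>2 = (s t)\<^sup>2 + 2 * l * cos t * \<kappa>"
      by (simp add: s_def)
    have "Re (a * (\<phi> t * of_real (cos t)) + of_real l * (b * \<phi> t)) = Re (\<phi> t * w)"
      by (simp add: w_def algebra_simps)
    also have "\<dots> \<le> cmod (\<phi> t) * cmod w" by (metis complex_Re_le_cmod norm_mult)
    also have "\<dots> \<le> cmod w" using \<phi>[of t] by (simp add: mult_left_le_one_le)
    also have "\<dots> \<le> s t + l * \<kappa> * (cos t / s t)"
    proof -
      \<comment> \<open>AM-GM against \<open>s t\<close>, which is the value of
        \<open>cmod w\<close> when \<kappa> = 0. After division by \<open>s t\<close> the cross term
        is a multiple of \<open>cos t / s t\<close>, as required for its integral to vanish.\<close>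
      have "0 \<le> (cmod w - s t)\<^sup>2" by simp
      then have "2 * cmod w * s t \<le> (s t)\<^sup>2 + 2 * l * cos t * \<kappa> + (s t)\<^sup>2"
        unfolding power2_diff w by simp
      then have "cmod w * s t \<le> (s t)\<^sup>2 + l * \<kappa> * cos t" by (simp add: algebra_simps)
      then show ?thesis using s[of t] by (simp add: field_simps power2_eq_square)
    qed
    finally show ?thesis .
  qed
  then show ?thesis using has_integral_le[OF L R] by (simp add: s_def[abs_def])
qed

text \<open>Serves the value p = 0, whose multiplier would be l = 0, outside the range of
  \<open>circle_duality_bound\<close>.\<close>

lemma circle_abs_cos_bound:
  fixes \<phi> :: "real \<Rightarrow> complex"
  assumes V: "((\<lambda>t. \<phi> t * of_real (cos t)) has_integral V) {0..2 * pi}"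
    and \<phi>: "\<And>t. cmod (\<phi> t) \<le> 1"
  shows "cmod V \<le> 4"
proof -
  have "norm (integral {0..2 * pi} (\<lambda>t. \<phi> t * of_real (cos t))) \<le> integral {0..2 * pi} (\<lambda>t. \<bar>cos t\<bar>)"
    using V has_integral_abs_cos \<phi>
    by (intro integral_norm_bound_integral) (auto simp: norm_mult mult_left_le_one_le)
  then show ?thesis using V has_integral_abs_cos by (simp add: integral_unique)
qed

section \<open>The function \<open>M_fun\<close>\<close>


text \<open>The l-derivative of the mean of sqrt(l^2 + cos^2 t); \<open>M_param\<close> is its
  inverse on the open unit interval.\<close>

definition lambda_mean :: "real \<Rightarrow> real" where
  "lambda_mean l = integral {0..2 * pi} (\<lambda>t. l / sqrt (l\<^sup>2 + (cos t)\<^sup>2)) / (2 * pi)"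

lemma continuous_on_over_sqrt_cos:
  assumes "0 < l" "continuous_on A h"
  shows "continuous_on A (\<lambda>t. h t / sqrt (l\<^sup>2 + (cos t)\<^sup>2))"
  using sqrt_cos_pos[OF assms(1)] assms(2)
  by (intro continuous_on_divide continuous_on_sqrt_cos) (auto simp: less_imp_neq[THEN not_sym])

lemma over_sqrt_mono:
  fixes l m q :: real
  assumes "0 < l" "l \<le> m" "0 \<le> q"
  shows "l / sqrt (l\<^sup>2 + q) \<le> m / sqrt (m\<^sup>2 + q)"
proof -
  have *: "x / sqrt (x\<^sup>2 + q) = sqrt (x\<^sup>2 / (x\<^sup>2 + q))" if "0 < x" for x
    using that by (simp add: real_sqrt_divide)
  have "l\<^sup>2 * q \<le> m\<^sup>2 * q" using assms by (intro mult_right_mono power_mono) auto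
  then have "l\<^sup>2 * (m\<^sup>2 + q) \<le> m\<^sup>2 * (l\<^sup>2 + q)" by (simp add: algebra_simps)
  moreover have "0 < l\<^sup>2 + q" "0 < m\<^sup>2 + q" using assms by (auto intro!: add_pos_nonneg)
  ultimately have "l\<^sup>2 / (l\<^sup>2 + q) \<le> m\<^sup>2 / (m\<^sup>2 + q)"
    by (simp add: divide_le_eq le_divide_eq mult.commute)
  then show ?thesis using assms * by simp
qed

lemma over_sqrt_strict_mono:
  fixes l m :: real
  assumes "0 < l" "l < m"
  shows "l / sqrt (l\<^sup>2 + 1) < m / sqrt (m\<^sup>2 + 1)"
proof -
  have *: "x / sqrt (x\<^sup>2 + 1) = sqrt (x\<^sup>2 / (x\<^sup>2 + 1))" if "0 < x" for x :: real
    using that by (simp add: real_sqrt_divide)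
  have "l\<^sup>2 < m\<^sup>2" using assms by (intro power_strict_mono) auto
  moreover have "0 < l\<^sup>2 + 1" "0 < m\<^sup>2 + 1" by (auto intro!: add_nonneg_pos)
  ultimately have "l\<^sup>2 / (l\<^sup>2 + 1) < m\<^sup>2 / (m\<^sup>2 + 1)"
    by (simp add: divide_less_eq less_divide_eq algebra_simps)
  then show ?thesis using assms * by simp
qed

lemma lambda_mean_strict_mono:
  assumes "0 < l" "l < m"
  shows "lambda_mean l < lambda_mean m"
proof -
  let ?f = "\<lambda>l t. l / sqrt (l\<^sup>2 + (cos t)\<^sup>2)"
  have cont: "continuous_on {0..2 * pi} (?f x)" if "0 < x" for x
    using that by (intro continuous_on_over_sqrt_cos) auto
  let ?d = "\<lambda>t. ?f m t - ?f l t"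
  have d: "continuous_on {0..2 * pi} ?d"
    using cont assms by (intro continuous_on_diff) auto
  have nn: "0 \<le> ?d t" for t
    using over_sqrt_mono[of l m "(cos t)\<^sup>2"] assms by simp
  have "?d 0 \<noteq> 0" using over_sqrt_strict_mono[OF assms] by simp
  then have "integral {0..2 * pi} ?d \<noteq> 0"
    using integral_eq_0_iff[OF d] nn by fastforce
  moreover have "integral {0..2 * pi} ?d \<ge> 0"
    using nn d by (intro integral_nonneg integrable_continuous_interval) auto
  moreover have "integral {0..2 * pi} ?d = integral {0..2 * pi} (?f m) - integral {0..2 * pi} (?f l)"
    using cont assms by (intro integral_diff integrable_continuous_interval) auto
  ultimately show ?thesis
    by (simp add: lambda_mean_def divide_strict_right_mono)
qed

lemma continuous_on_lambda_mean: "continuous_on {0<..} lambda_mean"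
proof -
  have "continuous_on ({0<..} \<times> cbox 0 (2 * pi)) (\<lambda>(l, t). l / sqrt (l\<^sup>2 + (cos t)\<^sup>2))"
    unfolding split_beta using sqrt_cos_pos
    by (intro continuous_intros) (fastforce simp: less_imp_neq[THEN not_sym])
  from integral_continuous_on_param[OF this]
  have "continuous_on {0<..} (\<lambda>l. integral (cbox 0 (2 * pi)) (\<lambda>t. l / sqrt (l\<^sup>2 + (cos t)\<^sup>2)))" .
  then show ?thesis unfolding lambda_mean_def[abs_def] cbox_interval
    by (intro continuous_intros) auto
qed

lemma finite_cos_zeros: "finite {t \<in> {0..2 * pi}. cos t = 0}"
proof (rule finite_subset)
  show "{t \<in> {0..2 * pi}. cos t = 0} \<subseteq> (\<lambda>i. of_int i * (pi / 2)) ` {0..4}"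
  proof
    fix t assume "t \<in> {t \<in> {0..2 * pi}. cos t = 0}"
    then obtain i where i: "t = of_int i * (pi / 2)" and t: "0 \<le> t" "t \<le> 2 * pi"
      using cos_zero_iff_int[of t] by auto
    have "0 \<le> (of_int i :: real)" using t(1) pi_gt_zero unfolding i zero_le_mult_iff by auto
    moreover have "of_int i * pi \<le> 4 * pi" using t(2) unfolding i by simp
    then have "of_int i \<le> (4::real)" by (simp only: mult_le_cancel_right_pos[OF pi_gt_zero])
    ultimately have "i \<in> {0..4}" by simp
    then show "t \<in> (\<lambda>i. of_int i * (pi / 2)) ` {0..4}" using i by blast
  qed
qed simp

text \<open>As l -> 0 the integrand tends to 0 except at the finitely many zeros of cos, where it
  stays 1. It never exceeds 1, so dominated convergence applies.\<close>

lemma lambda_mean_small: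
  assumes "0 < r"
  obtains l where "0 < l" "lambda_mean l < r"
proof -
  define f where "f k t = inverse (real (Suc k)) / sqrt ((inverse (real (Suc k)))\<^sup>2 + (cos t)\<^sup>2)" for k and t :: real
  define g where "g t = (if cos t = 0 then 1 else 0 :: real)" for t :: real
  have "(\<lambda>k. integral {0..2 * pi} (f k)) \<longlonglongrightarrow> integral {0..2 * pi} g"
  proof (rule dominated_convergence(2)[where h = "\<lambda>_. 1"])
    show "f k integrable_on {0..2 * pi}" for k
      unfolding f_def by (intro integrable_continuous_interval continuous_on_over_sqrt_cos) auto
    show "(\<lambda>_. 1 :: real) integrable_on {0..2 * pi}" by (rule integrable_const_ivl)
    show "norm (f k t) \<le> 1" for k t
    proof -
      have "sqrt ((inverse (real (Suc k)))\<^sup>2) \<le> sqrt ((inverse (real (Suc k)))\<^sup>2 + (cos t)\<^sup>2)"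
        by (intro real_sqrt_le_mono) simp
      then have "inverse (real (Suc k)) \<le> sqrt ((inverse (real (Suc k)))\<^sup>2 + (cos t)\<^sup>2)"
        by (simp only: real_sqrt_abs abs_of_pos inverse_positive_iff_positive of_nat_0_less_iff zero_less_Suc)
      moreover have "0 < sqrt ((inverse (real (Suc k)))\<^sup>2 + (cos t)\<^sup>2)"
        by (rule sqrt_cos_pos) simp
      ultimately show ?thesis
        unfolding f_def real_norm_def abs_divide by (subst divide_le_eq_1_pos) auto
    qed
    show "(\<lambda>k. f k t) \<longlonglongrightarrow> g t" for t
    proof (cases "cos t = 0")
      case True
      have "f k t = 1" for k
        unfolding f_def True by (simp del: of_nat_Suc)
      then show ?thesis using True by (simp add: g_def)
    next
      case False
      have "(\<lambda>k. inverse (real (Suc k)) / sqrt ((inverse (real (Suc k)))\<^sup>2 + (cos t)\<^sup>2))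
          \<longlonglongrightarrow> 0 / sqrt (0\<^sup>2 + (cos t)\<^sup>2)"
        using False by (intro tendsto_intros LIMSEQ_inverse_real_of_nat) auto
      then show ?thesis using False by (simp add: f_def g_def)
    qed
  qed
  moreover have "(g has_integral 0) {0..2 * pi}"
    by (rule has_integral_spike_finite[OF finite_cos_zeros _ has_integral_0]) (auto simp: g_def)
  ultimately have "(\<lambda>k. integral {0..2 * pi} (f k)) \<longlonglongrightarrow> 0" by (simp add: integral_unique)
  then have "eventually (\<lambda>k. integral {0..2 * pi} (f k) < r * (2 * pi)) sequentially"
    using assms by (intro order_tendstoD(2)) auto
  then obtain k where "integral {0..2 * pi} (f k) < r * (2 * pi)"
    by (meson eventually_happens trivial_limit_sequentially)
  then have "lambda_mean (inverse (real (Suc k))) < r"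
    unfolding lambda_mean_def f_def by (subst pos_divide_less_eq) auto
  then show ?thesis using that[of "inverse (real (Suc k))"] by simp
qed

lemma lambda_mean_large:
  assumes r: "0 < r" "r < 1"
  obtains l where "0 < l" "r \<le> lambda_mean l"
proof
  \<comment> \<open>The solution of l / sqrt(l^2 + 1) = r. Since cos^2 t is at most 1, this value
    bounds the integrand from below.\<close>
  define l where "l = r / sqrt (1 - r\<^sup>2)"
  have r2: "r\<^sup>2 < 1" using r by (simp add: power_less_one_iff)
  show l: "0 < l" using r r2 by (simp add: l_def)
  have "l\<^sup>2 + 1 = 1 / (1 - r\<^sup>2)" using r2 by (simp add: l_def power_divide field_simps)
  then have lr: "l / sqrt (l\<^sup>2 + 1) = r" using r r2 by (simp add: l_def real_sqrt_divide)
  have "r \<le> l / sqrt (l\<^sup>2 + (cos t)\<^sup>2)" for t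
  proof -
    have "sqrt (l\<^sup>2 + (cos t)\<^sup>2) \<le> sqrt (l\<^sup>2 + 1)"
      by (simp add: abs_square_le_1)
    then show ?thesis unfolding lr[symmetric]
      using l sqrt_cos_pos[OF l] by (intro divide_left_mono) (auto intro!: mult_pos_pos add_nonneg_pos)
  qed
  then have "integral {0..2 * pi} (\<lambda>_. r) \<le> integral {0..2 * pi} (\<lambda>t. l / sqrt (l\<^sup>2 + (cos t)\<^sup>2))"
    using l by (intro integral_le integrable_continuous_interval continuous_on_over_sqrt_cos) auto
  then show "r \<le> lambda_mean l"
    unfolding lambda_mean_def by (subst pos_le_divide_eq) (auto simp: mult.commute)
qed

text \<open>The intermediate value theorem gives a root and strict monotonicity its uniqueness, so
  the definite description in \<open>M_param\<close> denotes that root.\<close>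

lemma M_param:
  assumes r: "0 < r" "r < 1"
  shows "0 < M_param r" "lambda_mean (M_param r) = r"
proof -
  obtain a where a: "0 < a" "lambda_mean a < r" using r(1) by (rule lambda_mean_small)
  obtain b where b: "0 < b" "r \<le> lambda_mean b" using r by (rule lambda_mean_large)
  have "a \<le> b" using lambda_mean_strict_mono[of b a] a b by linarith
  moreover have "continuous_on {a..b} lambda_mean"
    using a by (intro continuous_on_subset[OF continuous_on_lambda_mean]) auto
  ultimately obtain l where l: "a \<le> l" "lambda_mean l = r"
    using IVT'[of lambda_mean a r b] a b by auto
  have "M_param r = (THE l. 0 < l \<and> r = lambda_mean l)"
    by (simp add: M_param_def lambda_mean_def)
  also have "\<dots> = l"
  proof (rule the_equality)
    show "0 < l \<and> r = lambda_mean l" using l a by simp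
    fix m assume "0 < m \<and> r = lambda_mean m"
    then show "m = l"
      using l a lambda_mean_strict_mono[of m l] lambda_mean_strict_mono[of l m]
      by (cases m l rule: linorder_cases) auto
  qed
  finally show "0 < M_param r" "lambda_mean (M_param r) = r" using l a by auto
qed

text \<open>Ensures that the quotients in \<open>H_metric\<close> are genuine on the polydisc and
  not the default value of a division by 0.\<close>

lemma M_fun_pos:
  assumes r: "0 \<le> r" "r < 1"
  shows "0 < M_fun r"
proof (cases "r = 0")
  case True
  then show ?thesis by (simp add: M_fun_def)
next
  case False
  define l where "l = M_param r"
  have l: "0 < l" using M_param(1)[of r] r False by (simp add: l_def)
  let ?f = "\<lambda>t. (cos t)\<^sup>2 / sqrt (l\<^sup>2 + (cos t)\<^sup>2)"
  have c: "continuous_on {0..2 * pi} ?f"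
    using l by (intro continuous_on_over_sqrt_cos continuous_intros)
  have nn: "?f t \<ge> 0" for t by simp
  have "?f 0 \<noteq> 0" using sqrt_cos_pos[OF l, of 0] by simp
  then have "integral {0..2 * pi} ?f \<noteq> 0"
    using integral_eq_0_iff[OF c] nn by fastforce
  moreover have "integral {0..2 * pi} ?f \<ge> 0"
    using c by (intro integral_nonneg integrable_continuous_interval) auto
  ultimately show ?thesis using False by (simp add: M_fun_def l_def)
qed

text \<open>With s = sqrt(l^2 + cos^2 t), split s as l * (l / s) + cos^2 t / s. At l =
  \<open>M_param (cmod p)\<close> the first part integrates to 2 pi l |p|, exactly the term that
  duality adds to \<open>cmod V\<close>; the second is \<open>pi * M_fun (cmod p)\<close>.\<close>

lemma circle_M_fun_bound:
  fixes \<phi> :: "real \<Rightarrow> complex"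
  assumes P: "(\<phi> has_integral of_real (2 * pi) * p) {0..2 * pi}" and p: "cmod p < 1"
    and V: "((\<lambda>t. \<phi> t * of_real (cos t)) has_integral V) {0..2 * pi}"
    and \<phi>: "\<And>t. cmod (\<phi> t) \<le> 1"
  shows "cmod V \<le> pi * M_fun (cmod p)"
proof (cases "p = 0")
  case True
  then show ?thesis using circle_abs_cos_bound[OF V \<phi>] by (simp add: M_fun_def)
next
  case False
  define l where "l = M_param (cmod p)"
  have l: "0 < l" "lambda_mean l = cmod p"
    using M_param[of "cmod p"] p False by (auto simp: l_def)
  have "sqrt (l\<^sup>2 + (cos t)\<^sup>2) = l * (l / sqrt (l\<^sup>2 + (cos t)\<^sup>2)) + (cos t)\<^sup>2 / sqrt (l\<^sup>2 + (cos t)\<^sup>2)" for t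
    using real_div_sqrt[of "l\<^sup>2 + (cos t)\<^sup>2"] by (simp add: add_divide_distrib power2_eq_square)
  then have "integral {0..2 * pi} (\<lambda>t. sqrt (l\<^sup>2 + (cos t)\<^sup>2))
      = integral {0..2 * pi} (\<lambda>t. l * (l / sqrt (l\<^sup>2 + (cos t)\<^sup>2)) + (cos t)\<^sup>2 / sqrt (l\<^sup>2 + (cos t)\<^sup>2))"
    by (intro integral_cong) blast
  also have "\<dots> = integral {0..2 * pi} (\<lambda>t. l * (l / sqrt (l\<^sup>2 + (cos t)\<^sup>2)))
      + integral {0..2 * pi} (\<lambda>t. (cos t)\<^sup>2 / sqrt (l\<^sup>2 + (cos t)\<^sup>2))"
    using l(1) by (intro integral_add integrable_continuous_interval continuous_on_mult continuous_on_const
        continuous_on_over_sqrt_cos continuous_intros)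
  also have "integral {0..2 * pi} (\<lambda>t. l * (l / sqrt (l\<^sup>2 + (cos t)\<^sup>2))) = l * (2 * pi * cmod p)"
    unfolding l(2)[symmetric] lambda_mean_def integral_mult_right by simp
  also have "integral {0..2 * pi} (\<lambda>t. (cos t)\<^sup>2 / sqrt (l\<^sup>2 + (cos t)\<^sup>2)) = pi * M_fun (cmod p)"
    using False by (simp add: M_fun_def l_def)
  finally show ?thesis
    using circle_duality_bound[OF P V \<phi> l(1)] by (simp add: norm_mult)
qed

section \<open>The infinitesimal inequality\<close>


text \<open>The functions are controlled only on the open disc, so the circle of radius \<rho> is
  used. This costs a factor \<rho> in the derivative, which disappears because \<rho> < 1 is
  arbitrary.\<close>

lemma harmonic_derivative_bound_at_0:
  assumes g: "g holomorphic_on ball 0 1" and k: "k holomorphic_on ball 0 1"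
    and bound: "\<And>z. z \<in> ball 0 1 \<Longrightarrow> cmod (g z + cnj (k z)) < 1"
  shows "cmod (deriv g 0 + cnj (deriv k 0)) \<le> M_fun (cmod (g 0 + cnj (k 0)))"
proof (rule field_le_mult_one_interval)
  fix \<rho> :: real assume \<rho>: "0 < \<rho>" "\<rho> < 1"
  define \<phi> where "\<phi> t = g (of_real \<rho> * cis t) + cnj (k (of_real \<rho> * cis t))" for t
  have "cmod (\<phi> t) \<le> 1" for t
    using bound[of "of_real \<rho> * cis t"] \<rho> by (simp add: \<phi>_def norm_mult)
  moreover have "cmod (g 0 + cnj (k 0)) < 1" using bound by simp
  ultimately have "cmod (of_real (pi * \<rho>) * (deriv g 0 + cnj (deriv k 0))) \<le> pi * M_fun (cmod (g 0 + cnj (k 0)))"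
    using harmonic_circle_means[OF g k \<rho>] by (intro circle_M_fun_bound[of \<phi>]) (auto simp: \<phi>_def[abs_def])
  moreover have "cmod (of_real (pi * \<rho>)) = pi * \<rho>" using \<rho> by (simp add: norm_mult)
  ultimately show "\<rho> * cmod (deriv g 0 + cnj (deriv k 0)) \<le> M_fun (cmod (g 0 + cnj (k 0)))"
    by (simp only: norm_mult mult.assoc mult_le_cancel_left_pos[OF pi_gt_zero])
qed

lemma harmonic_schwarz_pick:
  assumes g: "g holomorphic_on ball 0 1" and k: "k holomorphic_on ball 0 1"
    and bound: "\<And>z. z \<in> ball 0 1 \<Longrightarrow> cmod (g z + cnj (k z)) < 1"
    and z: "z \<in> ball 0 1"
  shows "cmod (deriv g z * \<xi> + cnj (deriv k z * \<xi>))
    \<le> M_fun (cmod (g z + cnj (k z))) * (cmod \<xi> / (1 - (cmod z)\<^sup>2))"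
proof (cases "\<xi> = 0")
  case True
  then show ?thesis by simp
next
  case False
  \<comment> \<open>The estimate at the origin concerns direction 1 only; rotating by
    \<open>u\<close> turns that direction into the direction of \<xi>.\<close>
  define u where "u = \<xi> / of_real (cmod \<xi>)"
  have u: "cmod u = 1" using False by (simp add: u_def norm_divide)
  \<comment> \<open>A disc automorphism sending 0 to \<open>z\<close>, with derivative
    \<open>u * (1 - (cmod z)\<^sup>2)\<close> at 0.\<close>
  define \<psi> where "\<psi> w = Moebius_function 0 (-z) (u * w)" for w
  have z1: "cmod (-z) < 1" using z by simp
  have "(Moebius_function 0 (-z) \<circ> (\<lambda>w. u * w)) holomorphic_on ball 0 1"
    by (rule holomorphic_on_compose_gen[OF _ Moebius_function_holomorphic[OF z1]])
      (auto intro!: holomorphic_intros simp: norm_mult u)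
  then have \<psi>: "\<psi> holomorphic_on ball 0 1" by (simp add: \<psi>_def[abs_def] o_def)
  have maps: "\<psi> w \<in> ball 0 1" if "w \<in> ball 0 1" for w
    using Moebius_function_norm_lt_1[OF z1, of "u * w"] that by (simp add: \<psi>_def norm_mult u)
  have \<psi>0: "\<psi> 0 = z" by (simp add: \<psi>_def Moebius_function_of_zero)
  define r where "r = 1 - (cmod z)\<^sup>2"
  have r: "0 < r" using z by (simp add: r_def power_less_one_iff)
  have d\<psi>: "(\<psi> has_field_derivative u * of_real r) (at 0)"
  proof -
    have "((\<lambda>w. (u * w - -z) / (1 - cnj (-z) * (u * w))) has_field_derivative u - z * (cnj z * u)) (at 0)"
      by (auto intro!: derivative_eq_intros)
    moreover have "u - z * (cnj z * u) = u * of_real r"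
      using complex_norm_square[of z] by (simp add: r_def algebra_simps)
    ultimately show ?thesis by (simp add: \<psi>_def[abs_def] Moebius_function_simple)
  qed
  have der: "deriv (\<lambda>w. h (\<psi> w)) 0 = deriv h z * u * of_real r" if "h holomorphic_on ball 0 1" for h
  proof -
    have "(h has_field_derivative deriv h z) (at (\<psi> 0))"
      using holomorphic_derivI[OF that _ z] \<psi>0 by simp
    from DERIV_chain2[OF this d\<psi>] show ?thesis by (simp add: DERIV_imp_deriv mult.assoc)
  qed
  have hol: "(\<lambda>w. h (\<psi> w)) holomorphic_on ball 0 1" if "h holomorphic_on ball 0 1" for h
    using holomorphic_on_compose_gen[OF \<psi> that image_subsetI[OF maps]] by (simp add: o_def)
  have "cmod (deriv (\<lambda>w. g (\<psi> w)) 0 + cnj (deriv (\<lambda>w. k (\<psi> w)) 0)) \<le> M_fun (cmod (g (\<psi> 0) + cnj (k (\<psi> 0))))"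
    by (rule harmonic_derivative_bound_at_0) (use hol g k bound maps in auto)
  then have "cmod (deriv g z * u * of_real r + cnj (deriv k z * u * of_real r)) \<le> M_fun (cmod (g z + cnj (k z)))"
    by (simp only: der[OF g] der[OF k] \<psi>0)
  also have "deriv g z * u * of_real r + cnj (deriv k z * u * of_real r)
      = (deriv g z * \<xi> + cnj (deriv k z * \<xi>)) * of_real (r / cmod \<xi>)"
    by (simp add: u_def algebra_simps add_divide_distrib)
  finally have "cmod (deriv g z * \<xi> + cnj (deriv k z * \<xi>)) * (r / cmod \<xi>) \<le> M_fun (cmod (g z + cnj (k z)))"
    using r by (simp add: norm_mult norm_divide)
  then show ?thesis using r False by (simp add: r_def[symmetric] field_simps)
qed

section \<open>Maps into the polydisc\<close>

lemma has_derivative_vec_lambda: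
  fixes f :: "'n::finite \<Rightarrow> 'a::real_normed_vector \<Rightarrow> 'b::euclidean_space"
  assumes "\<And>j. (f j has_derivative f' j) (at z within S)"
  shows "((\<lambda>z. \<chi> j. f j z) has_derivative (\<lambda>h. \<chi> j. f' j h)) (at z within S)"
  unfolding has_derivative_componentwise_within[of "\<lambda>z. \<chi> j. f j z"]
  using assms by (auto simp: Basis_vec_def inner_axis intro!: has_derivative_inner_left)

lemma H_metric_le_iff:
  "H_metric p v \<le> B \<longleftrightarrow> (\<forall>j. 2 * cmod (v $ j) / M_fun (cmod (p $ j)) \<le> B)"
  by (simp add: H_metric_def Max_le_iff)

lemma H_metric_nonneg:
  assumes "p \<in> polydisc"
  shows "0 \<le> H_metric p v"
proof -
  fix j
  have "0 \<le> 2 * cmod (v $ j) / M_fun (cmod (p $ j))"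
    using M_fun_pos[of "cmod (p $ j)"] assms by (simp add: polydisc_def)
  also have "\<dots> \<le> H_metric p v" using H_metric_le_iff[of p v "H_metric p v"] by blast
  finally show ?thesis .
qed

text \<open>The derivative is exhibited through the holomorphic parts because its joint continuity
  in point and direction is what sends piecewise C^1 curves to piecewise C^1 curves.\<close>

lemma harmonic_map_derivative:
  fixes F :: "complex \<Rightarrow> complex ^ 'n"
  assumes F: "harmonic_map_on F (ball 0 1)"
  obtains D where "\<And>z. z \<in> ball 0 1 \<Longrightarrow> (F has_derivative D z) (at z)"
    and "continuous_on (ball 0 1 \<times> UNIV) (\<lambda>(z, \<xi>). D z \<xi>)"
    and "\<And>z \<xi>. F ` ball 0 1 \<subseteq> polydisc \<Longrightarrow> z \<in> ball 0 1 \<Longrightarrow> H_metric (F z) (D z \<xi>) \<le> poincare_metric z \<xi>"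
proof -
  have "\<exists>g k. g holomorphic_on ball 0 1 \<and> k holomorphic_on ball 0 1 \<and> (\<forall>z\<in>ball 0 1. F z $ j = g z + cnj (k z))" for j
    using harmonic_on_decomposition[of "ball 0 1" "\<lambda>z. F z $ j"] F
    by (metis harmonic_map_on_def open_ball convex_ball)
  then obtain g k where g: "\<And>j. g j holomorphic_on ball 0 1" and k: "\<And>j. k j holomorphic_on ball 0 1"
    and F_eq: "\<And>j z. z \<in> ball 0 1 \<Longrightarrow> F z $ j = g j z + cnj (k j z)"
    by metis
  define D :: "complex \<Rightarrow> complex \<Rightarrow> complex ^ 'n"
    where "D z \<xi> = (\<chi> j. deriv (g j) z * \<xi> + cnj (deriv (k j) z * \<xi>))" for z \<xi>
  show ?thesis
  proof
    fix z :: complex assume z: "z \<in> ball 0 1"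
    have "((\<lambda>z. \<chi> j. F z $ j) has_derivative D z) (at z)"
      unfolding D_def using g k z F_eq
      by (intro has_derivative_vec_lambda has_derivative_holomorphic_plus_cnj[of "ball 0 1"]) auto
    then show "(F has_derivative D z) (at z)" by simp
  next
    have dc: "continuous_on (ball 0 1 \<times> UNIV) (\<lambda>p. deriv h (fst p))" if "h holomorphic_on ball 0 1" for h :: "complex \<Rightarrow> complex"
      by (rule continuous_on_compose2[OF holomorphic_on_imp_continuous_on[OF holomorphic_deriv[OF that open_ball]]])
        (auto intro!: continuous_intros)
    show "continuous_on (ball 0 1 \<times> UNIV) (\<lambda>(z, \<xi>). D z \<xi>)"
      unfolding D_def split_beta
      by (intro continuous_on_vec_lambda continuous_on_add continuous_on_mult continuous_on_cnj continuous_on_snd continuous_on_id dc g k)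
  next
    fix z \<xi> :: complex assume F_in: "F ` ball 0 1 \<subseteq> polydisc" and z: "z \<in> ball 0 1"
    have lt: "cmod (g j w + cnj (k j w)) < 1" if "w \<in> ball 0 1" for j w
    proof -
      have "F w \<in> polydisc" using F_in that by blast
      then show ?thesis unfolding F_eq[OF that, symmetric] by (simp add: polydisc_def)
    qed
    show "H_metric (F z) (D z \<xi>) \<le> poincare_metric z \<xi>"
      unfolding H_metric_le_iff
    proof
      fix j
      have "cmod (D z \<xi> $ j) \<le> M_fun (cmod (F z $ j)) * (cmod \<xi> / (1 - (cmod z)\<^sup>2))"
        using harmonic_schwarz_pick[OF g k lt z, of j \<xi>] F_eq[OF z, of j] by (simp add: D_def)
      moreover have "0 < M_fun (cmod (F z $ j))"
        using lt[OF z, of j] F_eq[OF z, of j] by (intro M_fun_pos) auto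
      ultimately have "2 * cmod (D z \<xi> $ j) / M_fun (cmod (F z $ j))
          \<le> 2 * (M_fun (cmod (F z $ j)) * (cmod \<xi> / (1 - (cmod z)\<^sup>2))) / M_fun (cmod (F z $ j))"
        by (intro divide_right_mono mult_left_mono) auto
      also have "\<dots> = poincare_metric z \<xi>"
        using \<open>0 < M_fun (cmod (F z $ j))\<close> by (simp add: poincare_metric_def)
      finally show "2 * cmod (D z \<xi> $ j) / M_fun (cmod (F z $ j)) \<le> poincare_metric z \<xi>" .
    qed
  qed
qed

text \<open>\<open>Arctan\<close> is \<i>/2 times the logarithm of (1 - \<i>z) / (1 + \<i>z). This
  Cayley transform maps the disc into the right half-plane, where the imaginary part of
  \<open>Ln\<close> stays below pi/2 in modulus. Hence (4/pi) Re(Arctan z) maps the disc into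
  itself.\<close>

lemma Re_Arctan_bound:
  assumes "cmod z < 1"
  shows "\<bar>Re (Arctan z)\<bar> < pi / 4"
proof -
  have "(1 - \<i> * z) / (1 + \<i> * z) = (1 - \<i> * z) * cnj (1 + \<i> * z) / of_real ((cmod (1 + \<i> * z))\<^sup>2)"
    by (metis complex_div_cnj of_real_power)
  moreover have "Re ((1 - \<i> * z) * cnj (1 + \<i> * z)) = 1 - (cmod z)\<^sup>2"
    unfolding cmod_power2 by (simp add: algebra_simps power2_eq_square)
  ultimately have "Re ((1 - \<i> * z) / (1 + \<i> * z)) = (1 - (cmod z)\<^sup>2) / (cmod (1 + \<i> * z))\<^sup>2"
    by (simp only: Re_divide_of_real)
  moreover have "1 + \<i> * z \<noteq> 0"
  proof
    assume "1 + \<i> * z = 0"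
    then have "cmod (\<i> * z) = cmod (-1)" by (metis add.commute eq_neg_iff_add_eq_0)
    then show False using assms by (simp add: norm_mult)
  qed
  ultimately have "0 < Re ((1 - \<i> * z) / (1 + \<i> * z))"
    using assms by (simp add: power_less_one_iff)
  then have "\<bar>Im (Ln ((1 - \<i> * z) / (1 + \<i> * z)))\<bar> < pi / 2" by (rule Re_Ln_pos_lt_imp)
  then show ?thesis by (simp add: Arctan_def)
qed

section \<open>Lengths and distances\<close>


lemma C1_on_interval_compose:
  assumes \<gamma>: "C1_on_interval \<gamma> a b" and S: "\<gamma> ` {a..b} \<subseteq> S"
    and F: "\<And>z. z \<in> S \<Longrightarrow> (F has_derivative D z) (at z)"
    and D: "continuous_on (S \<times> UNIV) (\<lambda>(z, v). D z v)"
  shows "C1_on_interval (F \<circ> \<gamma>) a b"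
proof -
  obtain \<gamma>' where \<gamma>': "continuous_on {a..b} \<gamma>'"
    "\<And>t. t \<in> {a..b} \<Longrightarrow> (\<gamma> has_vector_derivative \<gamma>' t) (at t within {a..b})"
    using \<gamma> by (auto simp: C1_on_interval_def)
  have c\<gamma>: "continuous_on {a..b} \<gamma>"
    using \<gamma>'(2) has_vector_derivative_continuous continuous_on_eq_continuous_within by blast
  have "continuous_on {a..b} (\<lambda>t. (\<lambda>(z, v). D z v) (\<gamma> t, \<gamma>' t))"
    by (rule continuous_on_compose2[OF D]) (use \<gamma>'(1) c\<gamma> S in \<open>auto intro!: continuous_intros\<close>)
  then have "continuous_on {a..b} (\<lambda>t. D (\<gamma> t) (\<gamma>' t))" by simp
  moreover have "((F \<circ> \<gamma>) has_vector_derivative D (\<gamma> t) (\<gamma>' t)) (at t within {a..b})" if "t \<in> {a..b}" for t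
  proof -
    have "\<gamma> t \<in> S" using that S by blast
    from has_derivative_at_withinI[OF F[OF this]] show ?thesis
      by (rule vector_derivative_diff_chain_within[OF \<gamma>'(2)[OF that]])
  qed
  ultimately show ?thesis unfolding C1_on_interval_def by blast
qed

lemma partition_mono:
  fixes s :: "nat \<Rightarrow> real"
  assumes "\<And>i. i < m \<Longrightarrow> s i < s (Suc i)" "i \<le> j" "j \<le> m"
  shows "s i \<le> s j"
  using assms(2,3)
proof (induction j rule: dec_induct)
  case (step n)
  then show ?case using assms(1)[of n] by simp
qed simp

lemma partition_cover:
  fixes s :: "nat \<Rightarrow> real"
  assumes "t \<in> {s 0..s m}" "t \<notin> s ` {..m}"
  shows "\<exists>i<m. t \<in> {s i<..<s (Suc i)}"
  using assms
proof (induction m)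
  case 0
  then show ?case by auto
next
  case (Suc m)
  show ?case
  proof (cases "t \<le> s m")
    case True
    then have "\<exists>i<m. t \<in> {s i<..<s (Suc i)}" using Suc by (intro Suc.IH) auto
    then show ?thesis using less_Suc_eq by blast
  next
    case False
    then show ?thesis using Suc.prems by (intro exI[of _ m]) (auto simp: less_le)
  qed
qed

lemma piecewise_C1_path_partition:
  assumes "piecewise_C1_path \<gamma>"
  obtains s m where "s 0 = 0" "s m = 1" "\<And>i. i < m \<Longrightarrow> s i < s (Suc i)"
    "\<And>i. i < m \<Longrightarrow> C1_on_interval \<gamma> (s i) (s (Suc i))" "\<And>i. i < m \<Longrightarrow> {s i..s (Suc i)} \<subseteq> {0..1}"
proof -
  obtain s m where s: "s 0 = 0" "s m = 1" "\<And>i. i < m \<Longrightarrow> s i < s (Suc i)"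
    "\<And>i. i < m \<Longrightarrow> C1_on_interval \<gamma> (s i) (s (Suc i))"
    using assms unfolding piecewise_C1_path_def by blast
  have "{s i..s (Suc i)} \<subseteq> {0..1}" if "i < m" for i
    using partition_mono[of m s 0 i] partition_mono[of m s "Suc i" m] s that by auto
  then show ?thesis using that s by blast
qed

lemma piecewise_C1_path_compose:
  assumes \<gamma>: "piecewise_C1_path \<gamma>" and S: "path_image \<gamma> \<subseteq> S"
    and F: "\<And>z. z \<in> S \<Longrightarrow> (F has_derivative D z) (at z)"
    and D: "continuous_on (S \<times> UNIV) (\<lambda>(z, v). D z v)"
  shows "piecewise_C1_path (F \<circ> \<gamma>)"
proof -
  obtain s m where s: "s 0 = 0" "s m = 1" "\<And>i. i < m \<Longrightarrow> s i < s (Suc i)"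
    "\<And>i. i < m \<Longrightarrow> C1_on_interval \<gamma> (s i) (s (Suc i))" "\<And>i. i < m \<Longrightarrow> {s i..s (Suc i)} \<subseteq> {0..1}"
    using \<gamma> by (rule piecewise_C1_path_partition) blast
  have "C1_on_interval (F \<circ> \<gamma>) (s i) (s (Suc i))" if "i < m" for i
    using s(4)[OF that] _ F D
  proof (rule C1_on_interval_compose)
    show "\<gamma> ` {s i..s (Suc i)} \<subseteq> S" using s(5)[OF that] S by (auto simp: path_image_def)
  qed
  then show ?thesis unfolding piecewise_C1_path_def using s by blast
qed

text \<open>\<open>B\<close> consists of the break points, 0 and 1 included; elsewhere the
  derivative within a piece is a two-sided one.\<close>

lemma piecewise_C1_path_differentiable:
  assumes "piecewise_C1_path \<gamma>"
  obtains B where "finite B"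
    "\<And>t. t \<in> {0..1} - B \<Longrightarrow> (\<gamma> has_vector_derivative vector_derivative \<gamma> (at t)) (at t)"
proof -
  obtain s m where s: "s 0 = 0" "s m = 1" "\<And>i. i < m \<Longrightarrow> s i < s (Suc i)"
    "\<And>i. i < m \<Longrightarrow> C1_on_interval \<gamma> (s i) (s (Suc i))" "\<And>i. i < m \<Longrightarrow> {s i..s (Suc i)} \<subseteq> {0..1}"
    using assms by (rule piecewise_C1_path_partition) blast
  show ?thesis
  proof
    show "finite (s ` {..m})" by simp
    fix t assume t: "t \<in> {0..1} - s ` {..m}"
    then obtain i where i: "i < m" "t \<in> {s i<..<s (Suc i)}"
      using partition_cover[of t s m] s(1,2) by auto
    then obtain d where "(\<gamma> has_vector_derivative d) (at t within {s i..s (Suc i)})"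
      using s(4)[OF i(1)] unfolding C1_on_interval_def by fastforce
    moreover have "at t within {s i..s (Suc i)} = at t"
      using i(2) by (intro at_within_interior) (auto simp: interior_atLeastAtMost_real)
    ultimately have "(\<gamma> has_vector_derivative d) (at t)" by simp
    then show "(\<gamma> has_vector_derivative vector_derivative \<gamma> (at t)) (at t)"
      by (simp add: vector_derivative_at)
  qed
qed

text \<open>On each piece the speed agrees off the endpoints with a continuous function. This is
  applied to the metric of the source; for \<open>H_metric\<close> it would call for continuity of
  \<open>M_fun\<close>.\<close>

lemma integrable_metric_speed:
  assumes \<gamma>: "piecewise_C1_path \<gamma>" and S: "path_image \<gamma> \<subseteq> S"
    and N: "continuous_on (S \<times> UNIV) (\<lambda>(p, v). N p v :: real)"
  shows "(\<lambda>t. N (\<gamma> t) (vector_derivative \<gamma> (at t))) integrable_on {0..1}"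
proof -
  let ?f = "\<lambda>t. N (\<gamma> t) (vector_derivative \<gamma> (at t))"
  obtain s m where s: "s 0 = 0" "s m = 1" "\<And>i. i < m \<Longrightarrow> s i < s (Suc i)"
    "\<And>i. i < m \<Longrightarrow> C1_on_interval \<gamma> (s i) (s (Suc i))" "\<And>i. i < m \<Longrightarrow> {s i..s (Suc i)} \<subseteq> {0..1}"
    using \<gamma> by (rule piecewise_C1_path_partition) blast
  have piece: "?f integrable_on {s i..s (Suc i)}" if i: "i < m" for i
  proof -
    let ?a = "s i" and ?b = "s (Suc i)"
    obtain \<gamma>' where \<gamma>': "continuous_on {?a..?b} \<gamma>'"
      "\<And>t. t \<in> {?a..?b} \<Longrightarrow> (\<gamma> has_vector_derivative \<gamma>' t) (at t within {?a..?b})"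
      using s(4)[OF i] by (auto simp: C1_on_interval_def)
    have c\<gamma>: "continuous_on {?a..?b} \<gamma>"
      using \<gamma>'(2) has_vector_derivative_continuous continuous_on_eq_continuous_within by blast
    have "\<gamma> ` {?a..?b} \<subseteq> S" using s(5)[OF i] S by (auto simp: path_image_def)
    then have "continuous_on {?a..?b} (\<lambda>t. (\<lambda>(p, v). N p v) (\<gamma> t, \<gamma>' t))"
      by (intro continuous_on_compose2[OF N]) (use \<gamma>'(1) c\<gamma> in \<open>auto intro!: continuous_intros\<close>)
    then have "(\<lambda>t. N (\<gamma> t) (\<gamma>' t)) integrable_on {?a..?b}"
      by (intro integrable_continuous_interval) simp
    then show ?thesis
    proof (rule integrable_spike_finite[rotated 2])
      show "finite {?a, ?b}" by simp
      fix t assume t: "t \<in> {?a..?b} - {?a, ?b}"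
      then have "at t within {?a..?b} = at t"
        by (intro at_within_interior) (auto simp: interior_atLeastAtMost_real)
      then have "(\<gamma> has_vector_derivative \<gamma>' t) (at t)" using \<gamma>'(2)[of t] t by simp
      then show "?f t = N (\<gamma> t) (\<gamma>' t)" by (simp add: vector_derivative_at)
    qed
  qed
  have "?f integrable_on {s 0..s n}" if "n \<le> m" for n
    using that
  proof (induction n)
    case 0
    show ?case using integrable_on_refl[of ?f "s 0"] by simp
  next
    case (Suc n)
    show ?case
    proof (rule Henstock_Kurzweil_Integration.integrable_combine)
      show "s 0 \<le> s n" using partition_mono[of m s 0 n] s(3) Suc.prems by simp
      show "s n \<le> s (Suc n)" using s(3)[of n] Suc.prems by simp
      show "?f integrable_on {s 0..s n}" using Suc by simp
      show "?f integrable_on {s n..s (Suc n)}" using piece[of n] Suc.prems by simp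
    qed
  qed
  from this[of m] show ?thesis using s(1,2) by simp
qed

text \<open>If the speed of the image curve is not integrable, its length is the junk value \<open>0\<close>, for which
  the inequality holds as well.\<close>

lemma metric_length_compose_le:
  assumes \<gamma>: "piecewise_C1_path \<gamma>" and S: "path_image \<gamma> \<subseteq> S"
    and F: "\<And>z. z \<in> S \<Longrightarrow> (F has_derivative D z) (at z)"
    and N: "continuous_on (S \<times> UNIV) (\<lambda>(p, v). N p v)"
    and le: "\<And>z v. z \<in> S \<Longrightarrow> M (F z) (D z v) \<le> N z v"
    and nonneg: "\<And>z v. z \<in> S \<Longrightarrow> 0 \<le> M (F z) v"
  shows "metric_length M (F \<circ> \<gamma>) \<le> metric_length N \<gamma>"
proof -
  obtain B where B: "finite B"
    "\<And>t. t \<in> {0..1} - B \<Longrightarrow> (\<gamma> has_vector_derivative vector_derivative \<gamma> (at t)) (at t)"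
    using \<gamma> by (rule piecewise_C1_path_differentiable) blast
  let ?f = "\<lambda>t. M ((F \<circ> \<gamma>) t) (vector_derivative (F \<circ> \<gamma>) (at t))"
  let ?g = "\<lambda>t. N (\<gamma> t) (vector_derivative \<gamma> (at t))"
  have in_S: "\<gamma> t \<in> S" if "t \<in> {0..1}" for t using S that by (auto simp: path_image_def)
  have g: "?g integrable_on {0..1}" using \<gamma> S N by (rule integrable_metric_speed)
  have N_nonneg: "0 \<le> N z v" if "z \<in> S" for z v
    using le[OF that, of v] nonneg[OF that, of "D z v"] by simp
  show ?thesis
  proof (cases "?f integrable_on {0..1}")
    case True
    \<comment> \<open>At points of \<open>B\<close> the vector derivatives of the two curves are
      unrelated, so the integrand is set to 0 there before the pointwise comparison.\<close>
    have "integral {0..1} ?f = integral {0..1} (\<lambda>t. if t \<in> B then 0 else ?f t)"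
      using B(1) by (intro integral_spike[OF negligible_finite]) auto
    also have "\<dots> \<le> integral {0..1} ?g"
    proof (rule integral_le[OF _ g])
      show "(\<lambda>t. if t \<in> B then 0 else ?f t) integrable_on {0..1}"
        by (rule integrable_spike_finite[OF B(1) _ True]) simp
      fix t :: real assume t: "t \<in> {0..1}"
      show "(if t \<in> B then 0 else ?f t) \<le> ?g t"
      proof (cases "t \<in> B")
        case True
        then show ?thesis using N_nonneg[OF in_S[OF t]] by simp
      next
        case False
        then have "((F \<circ> \<gamma>) has_vector_derivative D (\<gamma> t) (vector_derivative \<gamma> (at t))) (at t)"
          using t by (intro vector_derivative_diff_chain_within[OF B(2) has_derivative_at_withinI[OF F[OF in_S]]]) auto
        then show ?thesis using False le[OF in_S[OF t]] by (simp add: vector_derivative_at)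
      qed
    qed
    finally show ?thesis by (simp add: metric_length_def)
  next
    case False
    then have "integral {0..1} ?f = 0" by (rule not_integrable_integral)
    moreover have "0 \<le> integral {0..1} ?g"
      using g N_nonneg in_S by (intro integral_nonneg) auto
    ultimately show ?thesis by (simp add: metric_length_def)
  qed
qed

lemma metric_length_nonneg:
  assumes "\<And>z v. z \<in> S \<Longrightarrow> 0 \<le> N z v" "path_image \<gamma> \<subseteq> S"
  shows "0 \<le> metric_length N \<gamma>"
proof (cases "(\<lambda>t. N (\<gamma> t) (vector_derivative \<gamma> (at t))) integrable_on {0..1}")
  case True
  then show ?thesis unfolding metric_length_def
    using assms by (intro integral_nonneg) (auto simp: path_image_def image_subset_iff)
next
  case False
  then show ?thesis by (simp add: metric_length_def not_integrable_integral)
qed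

lemma piecewise_C1_path_linepath: "piecewise_C1_path (linepath a b)"
proof -
  have "C1_on_interval (linepath a b) 0 1"
    unfolding C1_on_interval_def
    by (intro exI[of _ "\<lambda>_. b - a"]) (simp add: has_vector_derivative_linepath_within)
  then show ?thesis
    unfolding piecewise_C1_path_def by (intro exI[of _ real] exI[of _ 1]) simp
qed

text \<open>\<open>Inf\<close> on the reals is meaningful only for nonempty sets bounded below: a
  segment in the convex set \<open>S\<close> supplies a curve, and nonnegativity of \<open>M\<close>
  supplies the bound. Every curve in \<open>S\<close> then has an image in \<open>T\<close> that is
  no longer.\<close>

lemma path_dist_compose_le:
  fixes F :: "'a::real_normed_vector \<Rightarrow> 'b::real_normed_vector"
  assumes S: "convex S" "z0 \<in> S" "z1 \<in> S"
    and F: "\<And>z. z \<in> S \<Longrightarrow> (F has_derivative D z) (at z)"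
    and D: "continuous_on (S \<times> UNIV) (\<lambda>(z, v). D z v)"
    and N: "continuous_on (S \<times> UNIV) (\<lambda>(p, v). N p v)"
    and F_in: "F ` S \<subseteq> T"
    and le: "\<And>z v. z \<in> S \<Longrightarrow> M (F z) (D z v) \<le> N z v"
    and nonneg: "\<And>p v. p \<in> T \<Longrightarrow> 0 \<le> M p v"
  shows "path_dist T M (F z0) (F z1) \<le> path_dist S N z0 z1"
  unfolding path_dist_def
proof (rule cInf_mono)
  have "path_image (linepath z0 z1) \<subseteq> S"
    using S by (simp add: closed_segment_subset)
  then show "{metric_length N \<gamma> |\<gamma>. piecewise_C1_path \<gamma> \<and> path_image \<gamma> \<subseteq> S \<and> pathstart \<gamma> = z0 \<and> pathfinish \<gamma> = z1} \<noteq> {}"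
    using piecewise_C1_path_linepath[of z0 z1] by (auto intro!: exI[of _ "linepath z0 z1"])
  show "bdd_below {metric_length M \<gamma> |\<gamma>. piecewise_C1_path \<gamma> \<and> path_image \<gamma> \<subseteq> T \<and> pathstart \<gamma> = F z0 \<and> pathfinish \<gamma> = F z1}"
    by (rule bdd_belowI[of _ 0]) (use metric_length_nonneg[of T M] nonneg in blast)
next
  fix l assume "l \<in> {metric_length N \<gamma> |\<gamma>. piecewise_C1_path \<gamma> \<and> path_image \<gamma> \<subseteq> S \<and> pathstart \<gamma> = z0 \<and> pathfinish \<gamma> = z1}"
  then obtain \<gamma> where l: "l = metric_length N \<gamma>" and \<gamma>: "piecewise_C1_path \<gamma>" "path_image \<gamma> \<subseteq> S"
    "pathstart \<gamma> = z0" "pathfinish \<gamma> = z1" by blast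
  have "metric_length M (F \<circ> \<gamma>) \<le> l"
    unfolding l using \<gamma>(1,2) F N le
  proof (rule metric_length_compose_le)
    show "0 \<le> M (F z) v" if "z \<in> S" for z v using nonneg F_in that by blast
  qed
  moreover have "piecewise_C1_path (F \<circ> \<gamma>)"
    using \<gamma>(1,2) F D by (rule piecewise_C1_path_compose)
  moreover have "path_image (F \<circ> \<gamma>) \<subseteq> T"
    using \<gamma>(2) F_in by (auto simp: path_image_compose)
  ultimately show "\<exists>a\<in>{metric_length M \<gamma> |\<gamma>. piecewise_C1_path \<gamma> \<and> path_image \<gamma> \<subseteq> T \<and> pathstart \<gamma> = F z0 \<and> pathfinish \<gamma> = F z1}. a \<le> l"
    using \<gamma>(3,4) by (intro bexI[of _ "metric_length M (F \<circ> \<gamma>)"])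
      (auto simp: pathstart_compose pathfinish_compose intro!: exI[of _ "F \<circ> \<gamma>"])
qed

lemma continuous_on_poincare_metric:
  "continuous_on (ball 0 1 \<times> UNIV) (\<lambda>(z, \<xi>). poincare_metric z \<xi>)"
proof -
  have "1 - (cmod z)\<^sup>2 \<noteq> 0" if "z \<in> ball 0 1" for z :: complex
    using that by (simp add: power2_eq_1_iff) (smt (verit) norm_ge_zero)
  then show ?thesis unfolding poincare_metric_def split_beta
    by (intro continuous_intros) auto
qed

theorem theorem11p6:
  shows "(\<forall>F :: complex \<Rightarrow> complex ^ 'n.
            harmonic_map_on F (ball 0 1) \<and> F ` ball 0 1 \<subseteq> polydisc \<longrightarrow>
              (\<forall>z\<in>ball 0 1. \<forall>\<xi>.
                 H_metric (F z) (frechet_derivative F (at z) \<xi>)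
                   \<le> 2 * cmod \<xi> / (1 - (cmod z)\<^sup>2)) \<and>
              (\<forall>z0\<in>ball 0 1. \<forall>z1\<in>ball 0 1.
                 H_dist (F z0) (F z1) \<le> poincare_dist z0 z1)) \<and>
         (\<forall>c<1. \<not> (\<forall>F :: complex \<Rightarrow> complex ^ 'n.
            harmonic_map_on F (ball 0 1) \<and> F ` ball 0 1 \<subseteq> polydisc \<longrightarrow>
              (\<forall>z\<in>ball 0 1. \<forall>\<xi>.
                 H_metric (F z) (frechet_derivative F (at z) \<xi>)
                   \<le> c * (2 * cmod \<xi> / (1 - (cmod z)\<^sup>2)))))"
proof (intro conjI allI impI)
  fix F :: "complex \<Rightarrow> complex ^ 'n"
  assume *: "harmonic_map_on F (ball 0 1) \<and> F ` ball 0 1 \<subseteq> polydisc"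
  then obtain D where D: "\<And>z. z \<in> ball 0 1 \<Longrightarrow> (F has_derivative D z) (at z)"
    "continuous_on (ball 0 1 \<times> UNIV) (\<lambda>(z, \<xi>). D z \<xi>)"
    "\<And>z \<xi>. z \<in> ball 0 1 \<Longrightarrow> H_metric (F z) (D z \<xi>) \<le> poincare_metric z \<xi>"
    using harmonic_map_derivative[of F] by metis
  show "\<forall>z\<in>ball 0 1. \<forall>\<xi>. H_metric (F z) (frechet_derivative F (at z) \<xi>) \<le> 2 * cmod \<xi> / (1 - (cmod z)\<^sup>2)"
    using D(3) frechet_derivative_at[OF D(1)] by (simp add: poincare_metric_def)
  show "\<forall>z0\<in>ball 0 1. \<forall>z1\<in>ball 0 1. H_dist (F z0) (F z1) \<le> poincare_dist z0 z1"
    unfolding H_dist_def poincare_dist_def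
    using path_dist_compose_le[OF convex_ball _ _ D(1,2) continuous_on_poincare_metric _ D(3) H_metric_nonneg] *
    by blast
next
  fix c :: real assume c: "c < 1"
  define h where "h z = of_real (2 / pi) * Arctan z" for z
  \<comment> \<open>\<open>f\<close> is (4/pi) Re(Arctan z), written as a holomorphic function plus
    a conjugate so that harmonicity is immediate. All coordinates of \<open>F\<close> are equal to
    it.\<close>
  define f where "f z = h z + cnj (h z)" for z
  define F :: "complex \<Rightarrow> complex ^ 'n" where "F z = (\<chi> j. f z)" for z
  have "Arctan holomorphic_on ball 0 1"
    by (rule holomorphic_on_Arctan) (auto intro: le_less_trans[OF abs_Im_le_cmod])
  then have h: "h holomorphic_on ball 0 1"
    unfolding h_def by (intro holomorphic_intros)
  have "harmonic_map_on F (ball 0 1)"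
    using harmonic_on_holomorphic_plus_cnj[OF open_ball h h] by (simp add: harmonic_map_on_def F_def f_def)
  moreover have "cmod (f z) < 1" if "cmod z < 1" for z
  proof -
    have "f z = of_real (4 / pi * Re (Arctan z))"
      by (simp add: f_def h_def complex_eq_iff)
    then have "cmod (f z) = 4 / pi * \<bar>Re (Arctan z)\<bar>" by (simp only: norm_of_real abs_mult) simp
    also have "\<dots> < 4 / pi * (pi / 4)"
      using Re_Arctan_bound[OF that] by (intro mult_strict_left_mono) auto
    finally show ?thesis by simp
  qed
  then have "F ` ball 0 1 \<subseteq> polydisc" by (auto simp: polydisc_def F_def)
  \<comment> \<open>Every coordinate has derivative 4/pi = \<open>M_fun 0\<close> in direction 1, so
    the left side is 2 while the right side is 2c.\<close>
  moreover have "\<not> H_metric (F 0) (frechet_derivative F (at 0) 1) \<le> c * (2 * cmod 1 / (1 - (cmod 0)\<^sup>2))"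
  proof -
    have "(Arctan has_field_derivative 1) (at 0)"
      using has_field_derivative_Arctan[of 0] by simp
    then have "(h has_field_derivative of_real (2 / pi)) (at 0)"
      unfolding h_def by (auto intro!: derivative_eq_intros)
    then have dh: "deriv h 0 = of_real (2 / pi)" by (rule DERIV_imp_deriv)
    have "(F has_derivative (\<lambda>\<xi>. \<chi> j. deriv h 0 * \<xi> + cnj (deriv h 0 * \<xi>))) (at 0)"
      unfolding F_def
      by (intro has_derivative_vec_lambda has_derivative_holomorphic_plus_cnj[OF open_ball h h]) (auto simp: f_def)
    from fun_cong[OF frechet_derivative_at[OF this, symmetric], of 1]
    have "frechet_derivative F (at 0) 1 $ j = of_real (4 / pi)" for j
      by (simp add: dh flip: of_real_add)
    then have "cmod (frechet_derivative F (at 0) 1 $ j) = 4 / pi" for j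
      by (simp only: norm_of_real) simp
    moreover have "F 0 $ j = 0" for j by (simp add: F_def f_def h_def)
    ultimately show ?thesis using c by (simp add: H_metric_le_iff M_fun_def)
  qed
  ultimately show "\<not> (\<forall>F :: complex \<Rightarrow> complex ^ 'n.
      harmonic_map_on F (ball 0 1) \<and> F ` ball 0 1 \<subseteq> polydisc \<longrightarrow>
        (\<forall>z\<in>ball 0 1. \<forall>\<xi>. H_metric (F z) (frechet_derivative F (at z) \<xi>)
          \<le> c * (2 * cmod \<xi> / (1 - (cmod z)\<^sup>2))))"
    by (metis centre_in_ball zero_less_one)
qed

end
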